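(* Let $D$ be a link diagram on $\mathbb{R}^2$ with $N$ crossings, let $T$ be its Tait graph, let $\mathcal{R}=\mathcal{R}_T$ be the unsigning of $T$, and let $\mathcal{M}=\mathcal{M}_T\subset\Sigma_T$ be the unsigned medial graph of $\mathcal{R}$. Let $\delta$ be a cycle weight function on $\Sigma_T$ (any choice). Then the Kauffman bracket is given by the vertex model of the unsigned embedded graph $\mathcal{M}$: $$\langle D\rangle=(-A^2-A^{-2})^{-1}A^{N}\sum_{a\in AC(\mathcal{M})}W(\rho(a)),$$ where $\rho$ is the expansion map with parameter $r=A^{-2}$, and $W$ is the function from $\mathbb{Z}[A^{-2}]$-linear combinations of collections of oriented cycles to $\mathbb{Z}[A,A^{-1}]$ defined as the linear extension of $$W:\ \bigcup_i c_i\ \mapsto\ \prod_i(-A^2)^{\delta(c_i)} .$$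
   Context: **Kauffman bracket.** Let $D$ be a link diagram in $\mathbb{R}^2$. At a crossing, the A-smoothing merges the two regions swept out when the over-strand is rotated counterclockwise onto the under-strand; the B-smoothing is the other smoothing. A state is a choice of A- or B-smoothing at each crossing, and $$\langle D\rangle=\sum_{\mathfrak{s}}A^{\alpha(\mathfrak{s})-\beta(\mathfrak{s})}\,(-A^2-A^{-2})^{c(\mathfrak{s})-1},$$ the sum being over all states, with $\alpha,\beta$ the numbers of A-, B-smoothings and $c$ the number of closed curves of the smoothed diagram. **Tait graph.** Checkerboard colour the regions of $D\subset\mathbb{R}^2$ (adjacent regions have different colours) with the unbounded region white. The Tait graph is the edge-signed plane graph with one vertex in each black region and one edge through each crossing, joining the (possibly equal) vertices of the black regions meeting there. The edge has sign $+$ if the A-smoothing of the crossing locally merges the two black regions there, and sign $-$ if the A-smoothing separates them. **Ribbon graphs.** A ribbon graph is an orientable surface with boundary, presented as a union of discs (vertices) and ribbons $I\times I$, $I=[0,1]$ (edges), such that discs and ribbons meet in disjoint segments $\{0,1\}\times I$, each such segment lies on the boundary of exactly one disc and exactly one ribbon, and every ribbon contains exactly two such segments. **Unsigning $\mathcal{R}_G$ of an edge-signed plane graph $G$.** Let $\mathcal{G}$ be the fattening of $G$: the plane surface obtained by thickening each vertex to a disc and each edge $e$ to a ribbon $I\times I$ attached to the vertex discs along $\{0,1\}\times I$. Let $N_+\subset\mathbb{R}^2$ be the union of all vertex discs and of the ribbons of the positive edges; $\partial N_+$ is a collection of disjoint simple closed curves. The ribbon graph $\mathcal{R}_G$ has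 one (abstract) disc for each curve of $\partial N_+$, with that curve as boundary, and one ribbon for each edge $e$ of $G$: if $e$ is negative, its ribbon is the ribbon $I\times I$ of $e$ in $\mathcal{G}$, attached to $\partial N_+$ along $\{0,1\}\times I$; if $e$ is positive, its ribbon is the transverse band $[1/3,2/3]\times I$ inside the ribbon $I\times I$ of $e$, attached to $\partial N_+$ along $[1/3,2/3]\times\{0,1\}$. The resulting abstract surface is orientable. **Surface $\Sigma_G$ and medial graph $\mathcal{M}_G$.** $\Sigma_G$ is the closed orientable surface obtained from $\mathcal{R}_G$ by gluing a disc to each boundary component. Identify each ribbon $e$ of $\mathcal{R}_G$ with $I\times I$, attached to discs along $\{0,1\}\times I$. The graph $\mathcal{M}_G\subset\mathcal{R}_G\subset\Sigma_G$ has a vertex $v_e$ at the midpoint of each ribbon $e$ and vertices $v_{e_1},v_{e_2},v_{e_3},v_{e_4}$ at its corners $(0,0),(0,1),(1,0),(1,1)$; edges $(v_e,v_{e_i})$, $i=1,\dots,4$, inside the ribbon $e$; and, for each arc of the boundary of a disc of $\mathcal{R}_G$ that joins two corner vertices and does not run along a ribbon end, an edge inside the disc joining these two vertices parallel to that arc. The vertices $v_e$ are four-valent; all others are two-valent. **Smoothings.** The A-smoothing of $\mathcal{M}_G$ at $v_e$ replaces $v_e$ by two disjoint arcs, joining the edge to $v_{e_1}$ with the edge to $v_{e_2}$ and the edge to $v_{e_3}$ with the edge to $v_{e_4}$ (it separates the two ends of the ribbon $e$). The B-smoothing at $v_e$ joins the edge to $v_{e_1}$ with the edge to $v_{e_3}$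 and the edge to $v_{e_2}$ with the edge to $v_{e_4}$. A smoothing $s$ of $\mathcal{M}_G$ is the result of A- or B-smoothing every four-valent vertex $v_e$; its connected components are closed curves in $\Sigma_G$, called its cycles. **Arrow coverings.** An arrow covering of $\mathcal{M}_G$ (or of a smoothing) is an orientation of each edge such that every vertex has equally many incoming and outgoing edges (the two edges joined by an arc of a smoothing are oriented coherently). $AC(\mathcal{M}_G)$ is the set of arrow coverings of $\mathcal{M}_G$. An arrow covering of a smoothing is the same as a choice of orientation of each of its cycles. **Map $\rho$ with parameter $r$.** For $a\in AC(\mathcal{M}_G)$, $\rho(a)$ is the $\mathbb{Z}[r]$-linear combination of arrow coverings of smoothings obtained by expanding multilinearly over all four-valent vertices: at each $v_e$, replace the vertex by the sum of those smoothings (A with coefficient $1$, B with coefficient $r$) for which each of the two arcs joins an incoming edge to an outgoing edge of $a$; edge orientations are unchanged. (Of the six possible local orientations, two give only the A-smoothing, two give only $r$ times the B-smoothing, and two give the sum A $+\,r\,$B.) **Cycle weight function.** A cycle weight function on a surface $\Sigma$ is a function $\delta$ from closed oriented curves on $\Sigma$ to $\{+1,-1\}$ with $\delta(-c)=-\delta(c)$, where $-c$ is $c$ with the opposite orientation.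
   Formalization: Every black region is assumed to be an open disc (the formula fails otherwise, e.g. for two concentric circles), and a disc of R without ribbons contributes a closed loop to M (otherwise it fails for the round unknot). *)

theory Defs
  imports
    "HOL-Library.Numeral_Type"
    "HOL-Library.FuncSet"
    "HOL-Library.Poly_Mapping"
    "HOL-Combinatorics.Cycles"
    "HOL-Computational_Algebra.Polynomial"
    "HOL-Computational_Algebra.Fraction_Field"
    "Graph_Theory.Digraph"
begin

section \<open>Link diagrams in the plane\<close>

text \<open>
  A diagram is recorded, up to orientation preserving isotopy of the plane, by its crossings,
  the way the four strands leaving the crossings are connected, its crossingless components
  and the regions.

  A dart (x, i) is the i-th strand leaving the crossing x, where i is an integer mod 4 and the
  strands at x are numbered counterclockwise so that 0 and 2 belong to the under-strand and 1
  and 3 to the over-strand.  The map other_end sends a dart to the other end of the edge of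
  the diagram on which it lies.

  A side is a place where a region touches the diagram.  The side Inl (x, i) is the corner at x
  between the strands i and i + 1, which is also the left side of the edge leaving x along the
  strand i.  The two sides of a crossingless component o are Inr (o, True) and Inr (o, False).

  Connected components of a diagram may lie next to each other or be nested, hence several
  faces (boundary components of regions) may belong to the same region: the map region gives
  the region to which a side belongs.
\<close>

record ('x, 'o, 'r) diagram =
  crossings :: "'x set"
  other_end :: "'x \<times> 4 \<Rightarrow> 'x \<times> 4"
  circles :: "'o set"
  region :: "('x \<times> 4) + ('o \<times> bool) \<Rightarrow> 'r"
  unbounded :: "'r"

definition classes :: "'a set \<Rightarrow> ('a \<times> 'a) set \<Rightarrow> 'a set set" where
  "classes S R = S // ((R \<union> R\<inverse>)\<^sup>* \<inter> S \<times> S)"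

definition darts :: "('x, 'o, 'r) diagram \<Rightarrow> ('x \<times> 4) set" where
  "darts D = crossings D \<times> UNIV"

definition sides :: "('x, 'o, 'r) diagram \<Rightarrow> (('x \<times> 4) + ('o \<times> bool)) set" where
  "sides D = Inl ` darts D \<union> Inr ` (circles D \<times> UNIV)"

text \<open>
  Travelling along an edge with the side on the left, one arrives at its other end (y, j), and
  the corner on the left there is the one between the strands j - 1 and j.
\<close>

definition next_corner :: "('x, 'o, 'r) diagram \<Rightarrow> 'x \<times> 4 \<Rightarrow> 'x \<times> 4" where
  "next_corner D d = (case other_end D d of (y, j) \<Rightarrow> (y, j - 1))"

definition faces :: "('x, 'o, 'r) diagram \<Rightarrow> (('x \<times> 4) + ('o \<times> bool)) set set" where
  "faces D = classes (sides D) {(Inl d, Inl (next_corner D d)) |d. d \<in> darts D}"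

definition regions :: "('x, 'o, 'r) diagram \<Rightarrow> 'r set" where
  "regions D = insert (unbounded D) (region D ` sides D)"

definition same_component ::
    "('x, 'o, 'r) diagram \<Rightarrow> ((('x \<times> 4) + ('o \<times> bool)) \<times> (('x \<times> 4) + ('o \<times> bool))) set" where
  "same_component D =
     {(Inl d, Inl (other_end D d)) |d. d \<in> darts D}
     \<union> {(Inl (x, i), Inl (x, j)) |x i j. x \<in> crossings D}
     \<union> {(Inr (c, True), Inr (c, False)) |c. c \<in> circles D}"

definition components :: "('x, 'o, 'r) diagram \<Rightarrow> (('x \<times> 4) + ('o \<times> bool)) set set" where
  "components D = classes (sides D) (same_component D)"

definition same_region ::
    "('x, 'o, 'r) diagram \<Rightarrow> ((('x \<times> 4) + ('o \<times> bool)) \<times> (('x \<times> 4) + ('o \<times> bool))) set" where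
  "same_region D = {(p, q). p \<in> sides D \<and> q \<in> sides D \<and> region D p = region D q}"

text \<open>
  The last four conditions say that the data describe a diagram in the plane.  The equation for
  the number of faces is Euler's formula V - E + F = 2C, where V - E = V - 2V = - V for the
  crossings and V - E = 0 for the crossingless components: every connected component is
  drawn on a sphere.  The remaining ones say that the bipartite graph with vertices the
  components and the regions, and with an edge for every face, is a tree.  The empty diagram
  is allowed.
\<close>

definition link_diagram :: "('x, 'o, 'r) diagram \<Rightarrow> bool" where
  "link_diagram D \<longleftrightarrow>
     finite (crossings D) \<and> finite (circles D) \<and>
     (\<forall>d\<in>darts D. other_end D d \<in> darts D \<and> other_end D d \<noteq> d \<and> other_end D (other_end D d) = d) \<and>
     (\<forall>d\<in>darts D. region D (Inl (next_corner D d)) = region D (Inl d)) \<and>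
     card (faces D) = card (crossings D) + 2 * card (components D) \<and>
     (sides D \<noteq> {} \<longrightarrow> unbounded D \<in> region D ` sides D) \<and>
     card (classes (sides D) (same_component D \<union> same_region D)) \<le> 1 \<and>
     card (components D) + card (regions D) = card (faces D) + 1"

text \<open>The set B consists of the black regions.\<close>

definition checkerboard :: "('x, 'o, 'r) diagram \<Rightarrow> 'r set \<Rightarrow> bool" where
  "checkerboard D B \<longleftrightarrow>
     B \<subseteq> regions D \<and> unbounded D \<notin> B \<and>
     (\<forall>x\<in>crossings D. \<forall>i. (region D (Inl (x, i)) \<in> B) \<noteq> (region D (Inl (x, i - 1)) \<in> B)) \<and>
     (\<forall>c\<in>circles D. (region D (Inr (c, True)) \<in> B) \<noteq> (region D (Inr (c, False)) \<in> B))"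

text \<open>A region of a plane diagram is an open disc iff it has only one boundary component.\<close>

definition disc_region :: "('x, 'o, 'r) diagram \<Rightarrow> 'r \<Rightarrow> bool" where
  "disc_region D r \<longleftrightarrow> card {f \<in> faces D. region D ` f = {r}} = 1"


section \<open>The Kauffman bracket\<close>

datatype smoothing = SA | SB

text \<open>
  Rotated counterclockwise, the over-strand {1, 3} sweeps the corner between the strands 1 and 2
  and the one between 3 and 0.  Merging these two corners leaves arcs joining the strands
  0, 1 and the strands 2, 3.
\<close>

definition joined_strand :: "smoothing \<Rightarrow> 4 \<Rightarrow> 4" where
  "joined_strand t i =
     (case t of SA \<Rightarrow> if i = 0 \<or> i = 2 then i + 1 else i - 1
              | SB \<Rightarrow> if i = 0 \<or> i = 2 then i - 1 else i + 1)"

definition states :: "('x, 'o, 'r) diagram \<Rightarrow> ('x \<Rightarrow> smoothing) set" where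
  "states D = (crossings D \<rightarrow>\<^sub>E UNIV)"

definition num_curves :: "('x, 'o, 'r) diagram \<Rightarrow> ('x \<Rightarrow> smoothing) \<Rightarrow> nat" where
  "num_curves D s =
     card (classes (darts D)
       ({(d, other_end D d) |d. d \<in> darts D}
        \<union> {((x, i), (x, joined_strand (s x) i)) |x i. x \<in> crossings D}))
     + card (circles D)"

definition kauffman_bracket :: "'f::field \<Rightarrow> ('x, 'o, 'r) diagram \<Rightarrow> 'f" where
  "kauffman_bracket A D =
     (\<Sum>s\<in>states D.
        A powi (int (card {x \<in> crossings D. s x = SA}) - int (card {x \<in> crossings D. s x = SB}))
        * (- (A ^ 2) - A powi (-2)) powi (int (num_curves D s) - 1))"


section \<open>The Tait graph\<close>

text \<open>
  An edge-signed embedded graph given by its rotation system.  Every edge consists of two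
  half-edges h and twin h; the half-edges at the vertex base h are cyclically
  ordered counterclockwise by rot.
\<close>

record ('v, 'h) signed_graph =
  vertices :: "'v set"
  half_edges :: "'h set"
  base :: "'h \<Rightarrow> 'v"
  rot :: "'h \<Rightarrow> 'h"
  twin :: "'h \<Rightarrow> 'h"
  positive :: "'h \<Rightarrow> bool"

text \<open>
  The half-edges are the black corners; the one opposite to (x, i) is (x, i + 2).  The
  counterclockwise order around a point of a black disc is the order of the corners along its
  boundary.  (For a black region that is not a disc this order depends on choices, and the
  definition is not meant to be used.)  The A-smoothing merges the corners 1 and 3.
\<close>

definition tait_graph :: "('x, 'o, 'r) diagram \<Rightarrow> 'r set \<Rightarrow> ('r, 'x \<times> 4) signed_graph" where
  "tait_graph D B =
     \<lparr>vertices = B,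
      half_edges = {d \<in> darts D. region D (Inl d) \<in> B},
      base = (\<lambda>d. region D (Inl d)),
      rot = next_corner D,
      twin = (\<lambda>(x, i). (x, i + 2)),
      positive = (\<lambda>(x, i). i = 1 \<or> i = 3)\<rparr>"


section \<open>Ribbon graphs and the unsigning\<close>

text \<open>
  A ribbon graph is given by the corners of its ribbons and three involutions on them.  In the
  coordinates of the ribbon, end_mate exchanges the corners (a, 0) and (a, 1), which
  bound the same end of the ribbon, and side_mate exchanges (0, b) and (1, b).  The
  boundaries of the discs consist of ribbon ends and of the arcs between them, and
  arc_mate exchanges the two end points of such an arc.  Thus a disc with ribbons
  attached is an orbit of end_mate and arc_mate.  The discs with no ribbon
  attached are listed in bare_discs.
\<close>

record ('k, 'd) ribbon_graph =
  corners :: "'k set"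
  end_mate :: "'k \<Rightarrow> 'k"
  side_mate :: "'k \<Rightarrow> 'k"
  arc_mate :: "'k \<Rightarrow> 'k"
  bare_discs :: "'d set"

text \<open>
  The corner (h, True) lies on the left of the half-edge h, seen from its vertex, and
  (h, False) on the right.  Seen from the other end of the edge, left and right are exchanged.
\<close>

definition fattening :: "('v, 'h) signed_graph \<Rightarrow> ('h \<times> bool, 'v) ribbon_graph" where
  "fattening G =
     \<lparr>corners = half_edges G \<times> UNIV,
      end_mate = (\<lambda>(h, left). (h, \<not> left)),
      side_mate = (\<lambda>(h, left). (twin G h, \<not> left)),
      arc_mate = (\<lambda>(h, left). if left then (rot G h, False)
                              else (inv_into (half_edges G) (rot G) h, True)),
      bare_discs = vertices G - base G ` half_edges G\<rparr>"

text \<open>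
  The boundary of the union of the vertex discs and of the positive ribbons consists of the arcs
  of the discs of the fattening, the ends of the negative ribbons and the long sides of the positive
  ribbons.  The transverse band [1/3, 2/3] x I of a positive ribbon is attached to it along
  the middle thirds of the two long sides.  We identify the corner of the band at (1/3, b) with the corner
  (0, b) of the old ribbon and the one at (2/3, b) with (1, b): under this identification the ends
  of the band are the long sides of the old ribbon and vice versa, and the arcs of the boundary
  curves between consecutive attached segments correspond to the old arcs.
\<close>

definition unsigning :: "('v, 'h) signed_graph \<Rightarrow> ('h \<times> bool, 'v) ribbon_graph" where
  "unsigning G =
     (let F = fattening G in
      \<lparr>corners = corners F,
       end_mate = (\<lambda>k. if positive G (fst k) then side_mate F k else end_mate F k),
       side_mate = (\<lambda>k. if positive G (fst k) then end_mate F k else side_mate F k),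
       arc_mate = arc_mate F,
       bare_discs = bare_discs F\<rparr>)"


section \<open>The medial graph\<close>

definition ribbon_of :: "('k, 'd) ribbon_graph \<Rightarrow> 'k \<Rightarrow> 'k set" where
  "ribbon_of G k = {k, end_mate G k, side_mate G k, end_mate G (side_mate G k)}"

definition ribbons :: "('k, 'd) ribbon_graph \<Rightarrow> 'k set set" where
  "ribbons G = ribbon_of G ` corners G"

text \<open>
  The medial graph is a digraph in which every edge is present with both directions.  Besides
  the midpoints and the corners of the ribbons there is one more two-valent vertex for every disc
  without ribbons: the boundary of such a disc has no corners on it, and the medial graph
  contains one closed curve parallel to it, which we regard as a loop at this extra vertex.

  Outward k and Inward k are the two directions of the edge between the corner k
  and the midpoint of its ribbon; Along k leads from k to the other end of its arc;
  Around d b are the two directions of the loop in the bare disc d.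
\<close>

datatype ('k, 'd) mvertex = Midpoint "'k set" | Corner "'k" | Basepoint "'d"

datatype ('k, 'd) arrow = Outward "'k" | Inward "'k" | Along "'k" | Around "'d" bool

definition medial_graph ::
    "('k, 'd) ribbon_graph \<Rightarrow> (('k, 'd) mvertex, ('k, 'd) arrow) pre_digraph" where
  "medial_graph G =
     \<lparr>verts = Midpoint ` ribbons G \<union> Corner ` corners G \<union> Basepoint ` bare_discs G,
      arcs = Outward ` corners G \<union> Inward ` corners G \<union> Along ` corners G
             \<union> {Around d b |d b. d \<in> bare_discs G},
      tail = (\<lambda>e. case e of Outward k \<Rightarrow> Midpoint (ribbon_of G k) | Inward k \<Rightarrow> Corner k
                          | Along k \<Rightarrow> Corner k | Around d b \<Rightarrow> Basepoint d),
      head = (\<lambda>e. case e of Outward k \<Rightarrow> Corner k | Inward k \<Rightarrow> Midpoint (ribbon_of G k)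
                          | Along k \<Rightarrow> Corner (arc_mate G k) | Around d b \<Rightarrow> Basepoint d)\<rparr>"

fun flip :: "('k, 'd) ribbon_graph \<Rightarrow> ('k, 'd) arrow \<Rightarrow> ('k, 'd) arrow" where
  "flip G (Outward k) = Inward k"
| "flip G (Inward k) = Outward k"
| "flip G (Along k) = Along (arc_mate G k)"
| "flip G (Around d b) = Around d (\<not> b)"

text \<open>An arrow covering is given by the set of the chosen directions of the edges.\<close>

definition arrow_coverings :: "('k, 'd) ribbon_graph \<Rightarrow> ('k, 'd) arrow set set" where
  "arrow_coverings G =
     {a. a \<subseteq> arcs (medial_graph G) \<and>
         (\<forall>e\<in>arcs (medial_graph G). (e \<in> a) \<noteq> (flip G e \<in> a)) \<and>
         (\<forall>v\<in>verts (medial_graph G).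
            card {e \<in> a. head (medial_graph G) e = v} = card {e \<in> a. tail (medial_graph G) e = v})}"


section \<open>Smoothings and the expansion map\<close>

text \<open>The other end of the smoothing arc that starts with the edge to the corner k.\<close>

definition smoothing_mate :: "('k, 'd) ribbon_graph \<Rightarrow> smoothing \<Rightarrow> 'k \<Rightarrow> 'k" where
  "smoothing_mate G t k = (case t of SA \<Rightarrow> end_mate G k | SB \<Rightarrow> side_mate G k)"

definition coherent_smoothings ::
    "('k, 'd) ribbon_graph \<Rightarrow> ('k, 'd) arrow set \<Rightarrow> 'k set \<Rightarrow> smoothing set" where
  "coherent_smoothings G a e =
     {t. \<forall>k\<in>e. Inward k \<in> a \<longleftrightarrow> Outward (smoothing_mate G t k) \<in> a}"

text \<open>
  A smoothing is a function on the ribbons (that is, on the four-valent vertices), and an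
  arrow covering of it is a pair of the smoothing and the set of the chosen
  directions of the edges.
\<close>

definition rho ::
    "('k, 'd) ribbon_graph \<Rightarrow> 'c::comm_ring_1 \<Rightarrow> ('k, 'd) arrow set
      \<Rightarrow> (('k set \<Rightarrow> smoothing) \<times> ('k, 'd) arrow set) \<Rightarrow>\<^sub>0 'c" where
  "rho G r a =
     (\<Sum>s\<in>(\<Pi>\<^sub>E e\<in>ribbons G. coherent_smoothings G a e).
        Poly_Mapping.single (s, a) (\<Prod>e\<in>ribbons G. case s e of SA \<Rightarrow> 1 | SB \<Rightarrow> r))"


section \<open>Oriented cycles and their weights\<close>

text \<open>
  A closed oriented curve carried by the medial graph is a cyclic sequence of arrows, i.e. a class
  of lists modulo rotation.  It does not turn back, which guarantees that it differs from the
  opposite curve; all cycles of smoothings are of this kind.  A cycle weight function on the surface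
  enters only through its values on these curves, and any function on them with the stated
  properties extends to the other closed curves of the surface.
\<close>

definition cyclic_word :: "'a list \<Rightarrow> 'a list set" where
  "cyclic_word xs = {rotate n xs |n. True}"

definition closed_curves :: "('k, 'd) ribbon_graph \<Rightarrow> ('k, 'd) arrow list set set" where
  "closed_curves G =
     {cyclic_word xs |xs.
        xs \<noteq> [] \<and> set xs \<subseteq> arcs (medial_graph G) \<and>
        (\<forall>i<length xs.
           head (medial_graph G) (xs ! i) = tail (medial_graph G) (xs ! (Suc i mod length xs)) \<and>
           xs ! (Suc i mod length xs) \<noteq> flip G (xs ! i))}"

definition opposite_curve ::
    "('k, 'd) ribbon_graph \<Rightarrow> ('k, 'd) arrow list set \<Rightarrow> ('k, 'd) arrow list set" where
  "opposite_curve G c = (\<lambda>xs. rev (map (flip G) xs)) ` c"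

definition cycle_weight_function ::
    "('k, 'd) ribbon_graph \<Rightarrow> (('k, 'd) arrow list set \<Rightarrow> int) \<Rightarrow> bool" where
  "cycle_weight_function G \<delta> \<longleftrightarrow>
     (\<forall>c\<in>closed_curves G. \<delta> c \<in> {1, -1} \<and> \<delta> (opposite_curve G c) = - \<delta> c)"

text \<open>The arrow following a given one in a smoothing.\<close>

fun next_arrow ::
    "('k, 'd) ribbon_graph \<Rightarrow> ('k set \<Rightarrow> smoothing) \<Rightarrow> ('k, 'd) arrow \<Rightarrow> ('k, 'd) arrow" where
  "next_arrow G s (Inward k) = Outward (smoothing_mate G (s (ribbon_of G k)) k)"
| "next_arrow G s (Outward k) = Along k"
| "next_arrow G s (Along k) = Inward (arc_mate G k)"
| "next_arrow G s (Around d b) = Around d b"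

definition oriented_cycles ::
    "('k, 'd) ribbon_graph \<Rightarrow> ('k set \<Rightarrow> smoothing) \<times> ('k, 'd) arrow set
      \<Rightarrow> ('k, 'd) arrow list set set" where
  "oriented_cycles G sa =
     (\<lambda>e. cyclic_word (support (next_arrow G (fst sa)) e)) ` snd sa"

definition W ::
    "('k, 'd) ribbon_graph \<Rightarrow> (('k, 'd) arrow list set \<Rightarrow> int) \<Rightarrow> 'f::field
      \<Rightarrow> ((('k set \<Rightarrow> smoothing) \<times> ('k, 'd) arrow set) \<Rightarrow>\<^sub>0 'f) \<Rightarrow> 'f" where
  "W G \<delta> A p =
     (\<Sum>sa\<in>Poly_Mapping.keys p.
        Poly_Mapping.lookup p sa * (\<Prod>c\<in>oriented_cycles G sa. (- (A ^ 2)) powi \<delta> c))"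


text \<open>The indeterminate A in the field of fractions of the ring of Laurent polynomials.\<close>

definition indet :: "int poly fract" where
  "indet = Fract [:0, 1:] 1"

end

theory Submission
  imports Defs
begin

text \<open>
  Exchanging the sums over arrow coverings and over smoothings, the vertex model becomes a sum over
  smoothings \<open>s\<close> of the medial graph.  The coverings coherent with \<open>s\<close> are the independent choices
  of an orientation of each of its cycles, and since the two orientations of a cycle have opposite
  weights, each cycle contributes the factor $-A^2-A^{-2}$ whatever the cycle weight function is.
  Finally, the unsigning is built in such a way that the A-smoothing of the diagram at a crossing
  is the A-smoothing of the medial graph at the corresponding ribbon, for both signs of the edge
  of the Tait graph; so the cycles of \<open>s\<close> are the curves of the corresponding state.
\<close>

section \<open>Reversible flows on finite sets\<close>

text \<open>Three points carry the weight. A cycle must never coincide with its own reverse: it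
  would then admit no choice of orientation, and its factor would not be a sum of two opposite
  weights. Hence the flows below are required never to turn back. At a crossing the A-smoothing
  always joins the strands 0, 1 and 2, 3, while the black corners are either 0, 2 (negative edge) or
  1, 3 (positive edge). Exchanging ends and sides of the positive ribbons compensates for exactly
  this difference. The hypothesis that black regions are discs enters through the curves without
  crossings. A black annulus between two nested circles would be one bare disc of the ribbon graph,
  although it is bounded by two curves of every state.\<close>

lemma cyclic_word_rotate: "cyclic_word (rotate m xs) = cyclic_word xs"
proof
  show "cyclic_word (rotate m xs) \<subseteq> cyclic_word xs"
    by (auto simp: cyclic_word_def rotate_rotate)
  \<comment> \<open>The amount \<open>length xs - m mod length xs\<close> completes the rotation by
    \<open>m\<close> to full turns; going forward is necessary because amounts are natural
    numbers.\<close>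
  have "rotate n xs = rotate (n + (length xs - m mod length xs)) (rotate m xs)" for n
  proof (cases "xs = []")
    case False
    let ?l = "length xs"
    have "m mod ?l < ?l" "m = m mod ?l + ?l * (m div ?l)" using False by simp_all
    then have "n + (?l - m mod ?l) + m = n + (?l + ?l * (m div ?l))" by linarith
    then have "n + (?l - m mod ?l) + m = n + ?l * Suc (m div ?l)" by simp
    then have "(n + (?l - m mod ?l) + m) mod ?l = n mod ?l" by (metis mod_mult_self2)
    then show ?thesis
      by (metis rotate_conv_mod rotate_rotate)
  qed simp
  then show "cyclic_word xs \<subseteq> cyclic_word (rotate m xs)"
    unfolding cyclic_word_def by blast
qed

lemma self_in_cyclic_word: "xs \<in> cyclic_word xs"
  unfolding cyclic_word_def by (auto intro: exI[of _ 0])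

text \<open>Reversal turns rotation into its inverse, so one further \<open>rotate1\<close> undoes
  each step.\<close>

lemma cyclic_word_rev_rotate: "cyclic_word (rev (rotate n xs)) = cyclic_word (rev xs)"
proof (induction n)
  case (Suc n)
  have "rotate1 (rev (rotate1 ys)) = rev ys" for ys :: "'a list"
    by (cases ys) auto
  then have "rotate 1 (rev (rotate (Suc n) xs)) = rev (rotate n xs)" by simp
  then show ?case using Suc cyclic_word_rotate by metis
qed simp

lemma rev_image_cyclic_word: "rev ` cyclic_word xs = cyclic_word (rev xs)"
proof -
  have *: "rev ` cyclic_word xs \<subseteq> cyclic_word (rev xs)" for xs :: "'b list"
  proof
    fix ys assume "ys \<in> rev ` cyclic_word xs"
    then obtain n where "ys = rev (rotate n xs)" by (auto simp: cyclic_word_def)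
    then show "ys \<in> cyclic_word (rev xs)"
      using self_in_cyclic_word[of ys] cyclic_word_rev_rotate[of n xs] by simp
  qed
  have "cyclic_word (rev xs) = rev ` rev ` cyclic_word (rev xs)"
    by (simp add: image_image)
  also have "\<dots> \<subseteq> rev ` cyclic_word xs"
    using *[of "rev xs"] by (intro image_mono) simp
  finally show ?thesis using * by blast
qed

text \<open>\<open>p\<close> is the step to the next arrow and \<open>f\<close> turns an arrow
  around. \<open>p_f_p\<close> is time reversal: on \<open>X\<close>, conjugating \<open>p\<close>
  by \<open>f\<close> gives its inverse. The last two assumptions forbid turning back, at an arrow
  or between two consecutive ones.\<close>

locale reversible_flow =
  fixes X :: "'a set" and p f :: "'a \<Rightarrow> 'a"
  assumes finite_X: "finite X"
    and p_closed: "e \<in> X \<Longrightarrow> p e \<in> X"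
    and f_closed: "e \<in> X \<Longrightarrow> f e \<in> X"
    and f_f: "e \<in> X \<Longrightarrow> f (f e) = e"
    and p_f_p: "e \<in> X \<Longrightarrow> p (f (p e)) = f e"
    and f_neq: "e \<in> X \<Longrightarrow> f e \<noteq> e"
    and p_neq_f: "e \<in> X \<Longrightarrow> p e \<noteq> f e"
begin

section \<open>Orbits and periods\<close>

lemma pow_closed: "e \<in> X \<Longrightarrow> (p ^^ n) e \<in> X"
  by (induction n) (auto simp: p_closed)

text \<open>Time reversal iterated. It exhibits an explicit inverse of \<open>p ^^ n\<close> on
  \<open>X\<close>, which is the source of injectivity.\<close>

lemma pow_f_pow: "e \<in> X \<Longrightarrow> (p ^^ n) (f ((p ^^ n) e)) = f e"
proof (induction n arbitrary: e)
  case (Suc n)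
  have "(p ^^ Suc n) (f ((p ^^ Suc n) e)) = p ((p ^^ n) (f ((p ^^ n) (p e))))"
    by (simp add: funpow_swap1)
  also have "\<dots> = f e"
    using Suc by (simp add: p_closed p_f_p)
  finally show ?case .
qed simp

lemma pow_inj: "e \<in> X \<Longrightarrow> e' \<in> X \<Longrightarrow> (p ^^ n) e = (p ^^ n) e' \<Longrightarrow> e = e'"
  by (metis pow_f_pow f_f)

text \<open>By finiteness two iterates agree; injectivity cancels the common initial steps, so the
  orbit is purely periodic and returns to \<open>e\<close>.\<close>

lemma least_power_props:
  assumes "e \<in> X"
  shows "(p ^^ least_power p e) e = e" and "least_power p e > 0"
proof -
  have "(\<lambda>n. (p ^^ n) e) ` UNIV \<subseteq> X"
    using assms pow_closed by auto
  then have "\<not> inj (\<lambda>n. (p ^^ n) e)"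
    using finite_X finite_imageD finite_subset by blast
  then obtain i j where ij: "i < j" "(p ^^ i) e = (p ^^ j) e"
    unfolding inj_on_def by (metis nat_neq_iff)
  then have "(p ^^ i) e = (p ^^ i) ((p ^^ (j - i)) e)"
    by (metis add_diff_inverse_nat comp_apply funpow_add not_less_iff_gr_or_eq)
  then have "(p ^^ (j - i)) e = e"
    using pow_inj assms pow_closed by metis
  moreover have "j - i > 0" using ij by simp
  ultimately show "(p ^^ least_power p e) e = e" and "least_power p e > 0"
    by (rule least_powerI)+
qed

lemma set_support:
  assumes "e \<in> X"
  shows "set (support p e) = range (\<lambda>n. (p ^^ n) e)"
proof -
  note l = least_power_props[OF assms]
  have "(p ^^ n) e \<in> set (support p e)" for n
    using funpow_mod_eq[OF l(1), of n] l(2)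
    by (auto intro!: image_eqI[of _ _ "n mod least_power p e"])
  then show ?thesis by auto
qed

lemma least_power_p:
  assumes "e \<in> X"
  shows "least_power p (p e) = least_power p e"
proof -
  have "(p ^^ n) (p e) = p e \<longleftrightarrow> (p ^^ n) e = e" for n
    using pow_inj[of "(p ^^ n) e" e 1] pow_closed[OF assms] assms funpow_swap1[of p n e] by auto
  then show ?thesis by (simp add: least_power_def)
qed

lemma least_power_f:
  assumes "e \<in> X"
  shows "least_power p (f e) = least_power p e"
proof -
  have "(p ^^ n) (f e) = f e \<longleftrightarrow> (p ^^ n) e = e" for n
    using pow_f_pow[of e n] pow_f_pow[of "f e" n] assms by (metis f_closed f_f)
  then show ?thesis by (simp add: least_power_def)
qed

section \<open>Oriented cycles as cyclic words\<close>

definition cyc :: "'a \<Rightarrow> 'a list set" where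
  "cyc e = cyclic_word (support p e)"

text \<open>Starting one step later moves the first entry to the end; at the wrap-around the period
  closes the word.\<close>

lemma cyc_p: assumes "e \<in> X" shows "cyc (p e) = cyc e"
proof -
  have "support p (p e) = rotate1 (support p e)"
  proof (rule nth_equalityI)
    fix i assume "i < length (support p (p e))"
    then have "i < least_power p e" by (simp add: least_power_p assms)
    then show "support p (p e) ! i = rotate1 (support p e) ! i"
      using funpow_mod_eq[OF least_power_props(1)[OF assms], of "Suc i"]
      by (simp add: least_power_p assms nth_rotate1 funpow_swap1)
  qed (simp add: least_power_p assms)
  then show ?thesis
    using cyclic_word_rotate[of 1 "support p e"] by (simp add: cyc_def)
qed

lemma cyc_pow: "e \<in> X \<Longrightarrow> cyc ((p ^^ n) e) = cyc e"
  by (induction n) (auto simp: cyc_p pow_closed)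

text \<open>A cyclic word determines the set of its letters, and by \<open>set_support\<close> this
  set is the orbit.\<close>

lemma cyc_eq_iff:
  assumes "e \<in> X" "e' \<in> X"
  shows "cyc e = cyc e' \<longleftrightarrow> (\<exists>n. e' = (p ^^ n) e)"
proof
  assume "cyc e = cyc e'"
  moreover have "support p e' \<in> cyc e'"
    unfolding cyc_def by (rule self_in_cyclic_word)
  ultimately obtain n where "support p e' = rotate n (support p e)"
    by (auto simp: cyc_def cyclic_word_def)
  then have "set (support p e') = set (support p e)" by (metis set_rotate)
  moreover have "e' \<in> set (support p e')"
    unfolding set_support[OF assms(2)] by (metis funpow_0 rangeI)
  ultimately show "\<exists>n. e' = (p ^^ n) e"
    using set_support[OF assms(1)] by auto
qed (use assms cyc_pow in auto)

lemma cyc_f_cong: "e \<in> X \<Longrightarrow> e' \<in> X \<Longrightarrow> cyc e = cyc e' \<Longrightarrow> cyc (f e) = cyc (f e')"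
  by (metis cyc_eq_iff pow_f_pow f_closed)

text \<open>If a cycle were its own reverse, its reversal would fix an arrow or exchange two consecutive ones.\<close>

lemma cyc_f_neq: assumes "e \<in> X" shows "cyc (f e) \<noteq> cyc e"
proof
  assume "cyc (f e) = cyc e"
  then obtain m where m: "f e = (p ^^ m) e"
    using assms cyc_eq_iff f_closed by metis
  \<comment> \<open>Half way along the path from \<open>e\<close> to \<open>f e\<close>: cancelling
    the remaining \<open>m div 2\<close> steps gives \<open>f e' = e'\<close> for even
    \<open>m\<close> and \<open>f e' = p e'\<close> for odd \<open>m\<close>.\<close>
  define e' where "e' = (p ^^ (m div 2)) e"
  have e': "e' \<in> X" using assms pow_closed by (simp add: e'_def)
  have eq: "(p ^^ (m div 2)) (f e') = (p ^^ (m div 2)) ((p ^^ (m mod 2)) e')"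
  proof -
    have "m div 2 + (m mod 2 + m div 2) = m" by presburger
    then have "(p ^^ (m div 2)) ((p ^^ (m mod 2)) e') = (p ^^ m) e"
      by (metis comp_apply e'_def funpow_add)
    then show ?thesis using pow_f_pow[OF assms, of "m div 2"] m by (simp add: e'_def)
  qed
  have "f e' = (p ^^ (m mod 2)) e'"
    by (rule pow_inj[OF _ _ eq]) (use e' f_closed pow_closed in auto)
  moreover have "m mod 2 = 0 \<or> m mod 2 = 1" by presburger
  ultimately show False
    using f_neq[OF e'] p_neq_f[OF e'] by auto
qed

lemma reverse_cyc: assumes "e \<in> X" shows "(\<lambda>xs. rev (map f xs)) ` cyc e = cyc (f e)"
proof -
  let ?l = "least_power p e"
  have l: "(p ^^ ?l) e = e" "?l > 0"
    using least_power_props[OF assms] by auto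
  \<comment> \<open>The rotation by one appears because the reversed word begins with the reversal
    of the last arrow, which is \<open>p (f e)\<close> and not \<open>f e\<close>.\<close>
  have "rev (map f (support p e)) = rotate1 (support p (f e))"
  proof (rule nth_equalityI)
    fix i assume "i < length (rev (map f (support p e)))"
    then have i: "i < ?l" by simp
    let ?j = "?l - Suc i"
    \<comment> \<open>Both sides are \<open>f e\<close>: the left by retracing \<open>?j\<close>
      steps, the right by completing a full period.\<close>
    have "(p ^^ ?j) (f ((p ^^ ?j) e)) = (p ^^ ?j) ((p ^^ Suc i) (f e))"
    proof -
      have "?j + Suc i = ?l" using i by simp
      then have "(p ^^ ?j) ((p ^^ Suc i) (f e)) = (p ^^ ?l) (f e)"
        by (metis comp_apply funpow_add)
      also have "\<dots> = f e"
        using least_power_props(1)[OF f_closed[OF assms]] by (simp add: least_power_f assms)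
      finally show ?thesis by (simp add: pow_f_pow assms)
    qed
    then have "f ((p ^^ ?j) e) = (p ^^ Suc i) (f e)"
      by (rule pow_inj[rotated 2]) (use assms f_closed pow_closed in blast)+
    moreover have "(p ^^ (Suc i mod ?l)) (f e) = (p ^^ Suc i) (f e)"
      by (rule funpow_mod_eq) (use least_power_props(1)[OF f_closed[OF assms]] in \<open>simp add: least_power_f assms\<close>)
    ultimately show "rev (map f (support p e)) ! i = rotate1 (support p (f e)) ! i"
      using i by (simp add: least_power_f assms rev_nth nth_rotate1 del: funpow.simps)
  qed (simp add: least_power_f assms)
  moreover have "map f ` cyclic_word xs = cyclic_word (map f xs)" for xs
    by (auto simp: cyclic_word_def rotate_map)
  moreover have "(\<lambda>xs. rev (map f xs)) ` cyc e = rev ` map f ` cyc e"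
    by (simp add: image_image)
  ultimately show ?thesis
    using cyclic_word_rotate[of 1 "support p (f e)"]
    by (simp add: cyc_def rev_image_cyclic_word del: rev_map map_map)
qed

section \<open>Unoriented cycles and their independent orientations\<close>

definition cyc_pair :: "'a \<Rightarrow> 'a list set set" where
  "cyc_pair e = {cyc e, cyc (f e)}"

lemma cyc_pair_f: "e \<in> X \<Longrightarrow> cyc_pair (f e) = cyc_pair e"
  by (auto simp: cyc_pair_def f_f)

lemma cyc_pair_cong:
  "e \<in> X \<Longrightarrow> e' \<in> X \<Longrightarrow> cyc e = cyc e' \<Longrightarrow> cyc_pair e = cyc_pair e'"
  using cyc_f_cong[of e e'] by (simp add: cyc_pair_def)

lemma cyc_pair_p: "e \<in> X \<Longrightarrow> cyc_pair (p e) = cyc_pair e"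
  by (intro cyc_pair_cong cyc_p p_closed)

text \<open>Serves to tell different cycles apart: the two words of a pair are linked by steps of
  \<open>p\<close> and one application of \<open>f\<close>.\<close>

lemma cyc_pair_invariant:
  assumes inv: "\<And>e. e \<in> X \<Longrightarrow> h (p e) = h e" "\<And>e. e \<in> X \<Longrightarrow> h (f e) = h e"
    and e: "e \<in> X" "e' \<in> X" "cyc_pair e = cyc_pair e'"
  shows "h e = h e'"
proof -
  have pow: "h ((p ^^ n) e) = h e" if "e \<in> X" for n e
    using that by (induction n) (auto simp: inv pow_closed)
  have "cyc e = cyc e' \<or> cyc (f e) = cyc e'"
    using e(3) by (auto simp: cyc_pair_def doubleton_eq_iff)
  then show ?thesis
  proof
    assume "cyc e = cyc e'"
    then show ?thesis using e cyc_eq_iff[of e e'] pow by auto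
  next
    assume "cyc (f e) = cyc e'"
    then show ?thesis using e cyc_eq_iff[of "f e" e'] pow inv(2) f_closed by auto
  qed
qed

text \<open>Orbits are periodic, so forward invariance makes a covering a union of whole oriented
  cycles; the last condition selects one from each opposite pair.\<close>

definition coverings :: "'a set set" where
  "coverings = {a. a \<subseteq> X \<and> p ` a \<subseteq> a \<and> (\<forall>e\<in>X. (e \<in> a) \<noteq> (f e \<in> a))}"

lemma covering_cyc:
  assumes "a \<in> coverings" "e \<in> a" "e' \<in> X" "cyc e = cyc e'"
  shows "e' \<in> a"
proof -
  have "(p ^^ n) e \<in> a" for n
    using assms(1,2) by (induction n) (auto simp: coverings_def)
  then show ?thesis
    using assms cyc_eq_iff[of e e'] unfolding coverings_def by blast
qed

text \<open>A covering amounts to a Boolean choice for every unoriented cycle. The sum over all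
  choices of a product factorises, and each factor is the two-term sum \<open>d\<close>.\<close>

lemma sum_coverings:
  fixes w :: "'a list set \<Rightarrow> 'c::comm_semiring_1"
  assumes w: "\<And>e. e \<in> X \<Longrightarrow> w (cyc e) + w (cyc (f e)) = d"
  shows "(\<Sum>a\<in>coverings. \<Prod>c\<in>cyc ` a. w c) = d ^ card (cyc_pair ` X)"
proof -
  define I where "I = cyc_pair ` X"
  \<comment> \<open>\<open>R i\<close> is a reference arrow on the cycle \<open>i\<close> and
    \<open>rep i\<close> gives its two directions. \<open>C\<close> builds the covering from a
    choice of directions, and \<open>S\<close> reads the choice off.\<close>
  define R where "R i = (SOME e. e \<in> X \<and> cyc_pair e = i)" for i
  define rep where "rep i b = (if b then R i else f (R i))" for i b
  define C where "C s = {e \<in> X. cyc e = cyc (rep (cyc_pair e) (s (cyc_pair e)))}" for s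
  define S where "S a = restrict (\<lambda>i. R i \<in> a) I" for a
  have R: "R i \<in> X" "cyc_pair (R i) = i" if "i \<in> I" for i
    unfolding R_def using someI_ex[of "\<lambda>e. e \<in> X \<and> cyc_pair e = i"] that by (auto simp: I_def)
  have rep: "rep i b \<in> X" "cyc_pair (rep i b) = i" "f (rep i b) = rep i (\<not> b)" if "i \<in> I" for i b
    using R[OF that] cyc_pair_f f_closed f_f by (auto simp: rep_def)
  \<comment> \<open>At least one direction fits by the definition of \<open>cyc_pair\<close>, and at
    most one by \<open>cyc_f_neq\<close>.\<close>
  have cases_rep: "cyc e = cyc (rep (cyc_pair e) b) \<longleftrightarrow> cyc e \<noteq> cyc (rep (cyc_pair e) (\<not> b))"
    if "e \<in> X" for e b
  proof -
    have i: "cyc_pair e \<in> I" using that by (simp add: I_def)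
    have "cyc e \<in> cyc_pair (rep (cyc_pair e) b)"
      unfolding rep(2)[OF i] by (simp add: cyc_pair_def)
    then have "cyc e \<in> {cyc (rep (cyc_pair e) b), cyc (rep (cyc_pair e) (\<not> b))}"
      unfolding cyc_pair_def[of "rep _ _"] rep(3)[OF i] .
    moreover have "cyc (rep (cyc_pair e) (\<not> b)) \<noteq> cyc (rep (cyc_pair e) b)"
      using cyc_f_neq[OF rep(1)[OF i, of b]] unfolding rep(3)[OF i] .
    ultimately show ?thesis by auto
  qed
  have C_rep: "rep i b \<in> C s \<longleftrightarrow> b = s i" if "i \<in> I" for i b s
  proof -
    have "cyc (rep i (\<not> b)) \<noteq> cyc (rep i b)"
      using cyc_f_neq[OF rep(1)[OF that, of b]] unfolding rep(3)[OF that] .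
    then have "cyc (rep i b) = cyc (rep i (s i)) \<longleftrightarrow> b = s i"
      by (cases b; cases "s i") simp_all
    then show ?thesis
      unfolding C_def mem_Collect_eq rep(2)[OF that] using rep(1)[OF that] by blast
  qed
  have finite_I: "finite I" using finite_X by (simp add: I_def)
  have C_coverings: "C s \<in> coverings" for s
  proof -
    have "(e \<in> C s) \<noteq> (f e \<in> C s)" if e: "e \<in> X" for e
    proof -
      let ?i = "cyc_pair e"
      have i: "?i \<in> I" using e by (simp add: I_def)
      have "cyc (f e) = cyc (rep ?i (s ?i)) \<longleftrightarrow> cyc e = cyc (rep ?i (\<not> s ?i))"
        using cyc_f_cong[of "f e" "rep ?i (s ?i)"] cyc_f_cong[of e "rep ?i (\<not> s ?i)"]
          rep[OF i, of "s ?i"] rep[OF i, of "\<not> s ?i"] f_closed[OF e] f_f[OF e] e by auto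
      then show ?thesis
        unfolding C_def mem_Collect_eq cyc_pair_f[OF e] using cases_rep[OF e, of "s ?i"] e f_closed[OF e] by blast
    qed
    moreover have "p e \<in> C s" if "e \<in> C s" for e
      using that unfolding C_def by (simp add: cyc_p cyc_pair_p p_closed)
    moreover have "C s \<subseteq> X" by (auto simp: C_def)
    ultimately show ?thesis
      unfolding coverings_def by blast
  qed
  have C_S: "C (S a) = a" if a: "a \<in> coverings" for a
  proof -
    have *: "rep i b \<in> a \<longleftrightarrow> b = S a i" if "i \<in> I" for i b
      using R(1)[OF that] a that by (auto simp: rep_def S_def coverings_def)
    have "e \<in> C (S a) \<longleftrightarrow> e \<in> a" if e: "e \<in> X" for e
    proof -
      let ?i = "cyc_pair e"
      have i: "?i \<in> I" using e by (simp add: I_def)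
      show ?thesis
      proof
        assume "e \<in> C (S a)"
        then have "cyc (rep ?i (S a ?i)) = cyc e" by (simp add: C_def)
        then show "e \<in> a" using covering_cyc[OF a _ e] *[OF i] by blast
      next
        assume "e \<in> a"
        show "e \<in> C (S a)"
        proof (rule ccontr)
          assume "e \<notin> C (S a)"
          then have "cyc e = cyc (rep ?i (\<not> S a ?i))"
            using cases_rep[OF e, of "\<not> S a ?i"] e by (auto simp: C_def)
          then show False
            using covering_cyc[OF a \<open>e \<in> a\<close> rep(1)[OF i]] *[OF i, of "\<not> S a ?i"] by simp
        qed
      qed
    qed
    then show ?thesis using a by (auto simp: coverings_def C_def)
  qed
  have S_C: "S (C s) = s" if "s \<in> I \<rightarrow>\<^sub>E UNIV" for s
  proof
    fix i show "S (C s) i = s i"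
      using C_rep[of i True s] that by (cases "i \<in> I") (auto simp: S_def rep_def)
  qed
  have prod_C: "(\<Prod>c\<in>cyc ` C s. w c) = (\<Prod>i\<in>I. w (cyc (rep i (s i))))" for s
  proof -
    have "cyc ` C s = (\<lambda>i. cyc (rep i (s i))) ` I"
    proof
      show "cyc ` C s \<subseteq> (\<lambda>i. cyc (rep i (s i))) ` I"
        by (auto simp: C_def I_def)
      show "(\<lambda>i. cyc (rep i (s i))) ` I \<subseteq> cyc ` C s"
        using C_rep by blast
    qed
    \<comment> \<open>The product ranges over a set of cycles, so equal cycles from different
      indices would be counted only once.\<close>
    moreover have "inj_on (\<lambda>i. cyc (rep i (s i))) I"
    proof (rule inj_onI)
      fix i j assume "i \<in> I" "j \<in> I" "cyc (rep i (s i)) = cyc (rep j (s j))"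
      then show "i = j"
        using cyc_pair_cong[of "rep i (s i)" "rep j (s j)"] rep(1,2) by simp
    qed
    ultimately show ?thesis by (simp add: prod.reindex)
  qed
  have "(\<Sum>a\<in>coverings. \<Prod>c\<in>cyc ` a. w c) = (\<Sum>s\<in>I \<rightarrow>\<^sub>E UNIV. \<Prod>i\<in>I. w (cyc (rep i (s i))))"
  proof (rule sum.reindex_bij_witness[of _ C S])
    fix a assume a: "a \<in> coverings"
    show "C (S a) = a" "S a \<in> I \<rightarrow>\<^sub>E UNIV"
      using C_S[OF a] by (auto simp: S_def)
    show "(\<Prod>i\<in>I. w (cyc (rep i (S a i)))) = (\<Prod>c\<in>cyc ` a. w c)"
      using prod_C[of "S a"] C_S[OF a] by simp
  qed (use S_C C_coverings in auto)
  also have "\<dots> = (\<Prod>i\<in>I. \<Sum>b\<in>UNIV. w (cyc (rep i b)))"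
    using finite_I by (subst prod_sum_PiE) auto
  also have "\<dots> = (\<Prod>i\<in>I. d)"
  proof (rule prod.cong[OF refl])
    fix i assume "i \<in> I"
    then show "(\<Sum>b\<in>UNIV. w (cyc (rep i b))) = d"
      using w[OF R(1)] by (simp add: UNIV_bool rep_def add.commute)
  qed
  finally show ?thesis by (simp add: I_def)
qed

end

section \<open>The vertex model of a ribbon graph\<close>

lemma rtrancl_image:
  assumes "(x, y) \<in> A\<^sup>*" and "\<And>a b. (a, b) \<in> A \<Longrightarrow> (h a, h b) \<in> B"
  shows "(h x, h y) \<in> B\<^sup>*"
  using assms(1) by induction (auto intro: rtrancl_into_rtrancl assms(2))

lemma symcl_rtrancl_const:
  assumes "(x, y) \<in> (R \<union> R\<inverse>)\<^sup>*" and "\<And>a b. (a, b) \<in> R \<Longrightarrow> h a = h b"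
  shows "h x = h y"
  using assms(1) by induction (auto dest: assms(2))

lemma equiv_symcl: "equiv S ((R \<union> R\<inverse>)\<^sup>* \<inter> S \<times> S)"
proof (rule equivI)
  have "sym ((R \<union> R\<inverse>)\<^sup>*)"
    by (rule sym_rtrancl) (auto simp: sym_def)
  then show "sym ((R \<union> R\<inverse>)\<^sup>* \<inter> S \<times> S)"
    by (auto simp: sym_def)
  show "trans ((R \<union> R\<inverse>)\<^sup>* \<inter> S \<times> S)"
    by (auto intro!: transI)
qed (auto simp: refl_on_def)

lemma card_image_same_kernel:
  assumes "\<And>x y. x \<in> S \<Longrightarrow> y \<in> S \<Longrightarrow> g x = g y \<longleftrightarrow> h x = h y"
  shows "card (g ` S) = card (h ` S)"
proof -
  have "bij_betw (\<lambda>z. h (inv_into S g z)) (g ` S) (h ` S)"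
  proof (rule bij_betw_imageI)
    have *: "h (inv_into S g (g x)) = h x" if "x \<in> S" for x
      using assms[OF inv_into_into[of "g x" g S] that] that by (simp add: f_inv_into_f)
    then show "inj_on (\<lambda>z. h (inv_into S g z)) (g ` S)"
      by (auto simp: inj_on_def assms)
    show "(\<lambda>z. h (inv_into S g z)) ` g ` S = h ` S"
      using * by (auto simp: image_image)
  qed
  then show ?thesis by (rule bij_betw_same_card)
qed

text \<open>Allows classes to be counted through any complete invariant \<open>g\<close>.\<close>

lemma card_classes:
  assumes "\<And>x y. x \<in> S \<Longrightarrow> y \<in> S \<Longrightarrow> g x = g y \<longleftrightarrow> (x, y) \<in> (R \<union> R\<inverse>)\<^sup>*"
  shows "card (classes S R) = card (g ` S)"
proof -
  let ?E = "(R \<union> R\<inverse>)\<^sup>* \<inter> S \<times> S"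
  have "classes S R = (\<lambda>x. ?E `` {x}) ` S"
    unfolding classes_def quotient_def by blast
  moreover have "?E `` {x} = ?E `` {y} \<longleftrightarrow> g x = g y" if "x \<in> S" "y \<in> S" for x y
    using eq_equiv_class_iff[OF equiv_symcl that] assms[OF that] that by simp
  ultimately show ?thesis
    using card_image_same_kernel[of S "\<lambda>x. ?E `` {x}" g] by simp
qed

text \<open>Because \<open>R\<close> stays inside \<open>S \<times> S\<close>, where
  \<open>inv_into\<close> undoes \<open>h\<close>, chains can be pulled back as well as pushed
  forward.\<close>

lemma card_classes_bij:
  assumes h: "bij_betw h S S'" and R: "R \<subseteq> S \<times> S"
  shows "card (classes S' (map_prod h h ` R)) = card (classes S R)"
proof -
  let ?R' = "map_prod h h ` R"
  let ?E' = "(?R' \<union> ?R'\<inverse>)\<^sup>* \<inter> S' \<times> S'"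
  have inv: "inv_into S h (h x) = x" if "x \<in> S" for x
    using h that by (simp add: bij_betw_def)
  have *: "(h x, h y) \<in> (?R' \<union> ?R'\<inverse>)\<^sup>* \<longleftrightarrow> (x, y) \<in> (R \<union> R\<inverse>)\<^sup>*" if "x \<in> S" "y \<in> S" for x y
  proof
    assume "(h x, h y) \<in> (?R' \<union> ?R'\<inverse>)\<^sup>*"
    then have "(inv_into S h (h x), inv_into S h (h y)) \<in> (R \<union> R\<inverse>)\<^sup>*"
      by (rule rtrancl_image) (use R inv in fastforce)
    then show "(x, y) \<in> (R \<union> R\<inverse>)\<^sup>*"
      by (simp add: inv that)
  next
    assume "(x, y) \<in> (R \<union> R\<inverse>)\<^sup>*"
    then show "(h x, h y) \<in> (?R' \<union> ?R'\<inverse>)\<^sup>*"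
      by (rule rtrancl_image) auto
  qed
  have "card (classes S R) = card ((\<lambda>x. ?E' `` {h x}) ` S)"
  proof (rule card_classes)
    fix x y assume xy: "x \<in> S" "y \<in> S"
    then have "h x \<in> S'" "h y \<in> S'" using h by (auto simp: bij_betw_def)
    then show "?E' `` {h x} = ?E' `` {h y} \<longleftrightarrow> (x, y) \<in> (R \<union> R\<inverse>)\<^sup>*"
      using eq_equiv_class_iff[OF equiv_symcl, of "h x" S' "h y" ?R'] *[OF xy] by simp
  qed
  also have "(\<lambda>x. ?E' `` {h x}) ` S = (\<lambda>x. ?E' `` {x}) ` S'"
    using h by (auto simp: bij_betw_def image_image)
  also have "\<dots> = classes S' ?R'"
    unfolding classes_def quotient_def by blast
  finally show ?thesis by simp
qed

text \<open>Different smoothings give different basis elements \<open>(s, a)\<close>, so no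
  coefficients merge. A summand with coefficient 0 is missing from \<open>keys\<close>, but it
  contributes 0 to the right-hand side too.\<close>

lemma W_rho:
  fixes A r :: "'f::field"
  assumes "finite (ribbons G)"
  shows "W G \<delta> A (rho G r a) =
    (\<Sum>s\<in>(\<Pi>\<^sub>E e\<in>ribbons G. coherent_smoothings G a e).
       (\<Prod>e\<in>ribbons G. case s e of SA \<Rightarrow> 1 | SB \<Rightarrow> r)
       * (\<Prod>c\<in>oriented_cycles G (s, a). (- (A ^ 2)) powi \<delta> c))"
    (is "_ = (\<Sum>s\<in>?T. ?c s * ?w (s, a))")
proof -
  have "finite (UNIV :: smoothing set)"
    by (rule finite_subset[of _ "{SA, SB}"]) (auto intro: smoothing.exhaust)
  then have T: "finite ?T"
    using assms by (intro finite_PiE) (auto intro: finite_subset)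
  have lookup: "Poly_Mapping.lookup (rho G r a) sa = (\<Sum>s\<in>?T. if (s, a) = sa then ?c s else 0)" for sa
    by (simp add: rho_def lookup_sum lookup_single when_def)
  then have *: "Poly_Mapping.lookup (rho G r a) (s, a) = ?c s" if "s \<in> ?T" for s
    using that T by simp
  have "Poly_Mapping.lookup (rho G r a) sa = 0" if "sa \<notin> (\<lambda>s. (s, a)) ` ?T" for sa
    unfolding lookup using that by (intro sum.neutral) auto
  then have "W G \<delta> A (rho G r a) =
      (\<Sum>sa\<in>(\<lambda>s. (s, a)) ` ?T. Poly_Mapping.lookup (rho G r a) sa * ?w sa)"
    unfolding W_def using T by (intro sum.mono_neutral_left) (auto simp: in_keys_iff)
  also have "\<dots> = (\<Sum>s\<in>?T. Poly_Mapping.lookup (rho G r a) (s, a) * ?w (s, a))"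
    by (subst sum.reindex) (auto intro: inj_onI)
  finally show ?thesis using * by simp
qed

text \<open>Connectivity of the smoothed medial graph, recorded on corners alone: once the midpoints
  are resolved, two corners are joined through a disc or through a ribbon.\<close>

definition smoothed_arcs :: "('k, 'd) ribbon_graph \<Rightarrow> ('k set \<Rightarrow> smoothing) \<Rightarrow> ('k \<times> 'k) set" where
  "smoothed_arcs G s = {(k, arc_mate G k) |k. k \<in> corners G}
     \<union> {(k, smoothing_mate G (s (ribbon_of G k)) k) |k. k \<in> corners G}"

text \<open>That the mates have no fixed points will exclude turning back. \<open>end_side\<close>
  makes the four corners of a ribbon an orbit of both mates, so \<open>ribbon_of\<close> does not
  change under a smoothing mate.\<close>

locale closed_ribbons =
  fixes G :: "('k, 'd) ribbon_graph"
  assumes finite_corners: "finite (corners G)"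
    and finite_bare: "finite (bare_discs G)"
    and mates: "k \<in> corners G \<Longrightarrow> end_mate G k \<in> corners G"
      "k \<in> corners G \<Longrightarrow> side_mate G k \<in> corners G"
      "k \<in> corners G \<Longrightarrow> arc_mate G k \<in> corners G"
    and involutions: "k \<in> corners G \<Longrightarrow> end_mate G (end_mate G k) = k"
      "k \<in> corners G \<Longrightarrow> side_mate G (side_mate G k) = k"
      "k \<in> corners G \<Longrightarrow> arc_mate G (arc_mate G k) = k"
    and mates_neq: "k \<in> corners G \<Longrightarrow> end_mate G k \<noteq> k"
      "k \<in> corners G \<Longrightarrow> side_mate G k \<noteq> k"
      "k \<in> corners G \<Longrightarrow> arc_mate G k \<noteq> k"
    and end_side: "k \<in> corners G \<Longrightarrow> end_mate G (side_mate G k) = side_mate G (end_mate G k)"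
begin

section \<open>The flow of a smoothing on the arrows of the medial graph\<close>

abbreviation "arrows \<equiv> arcs (medial_graph G)"

lemma arrows_eq: "arrows = Outward ` corners G \<union> Inward ` corners G \<union> Along ` corners G
    \<union> {Around d b |d b. d \<in> bare_discs G}"
  by (simp add: medial_graph_def)

lemma head_simps [simp]:
  "head (medial_graph G) (Outward k) = Corner k"
  "head (medial_graph G) (Inward k) = Midpoint (ribbon_of G k)"
  "head (medial_graph G) (Along k) = Corner (arc_mate G k)"
  "head (medial_graph G) (Around d b) = Basepoint d"
  by (simp_all add: medial_graph_def)

lemma tail_simps [simp]:
  "tail (medial_graph G) (Outward k) = Midpoint (ribbon_of G k)"
  "tail (medial_graph G) (Inward k) = Corner k"
  "tail (medial_graph G) (Along k) = Corner k"
  "tail (medial_graph G) (Around d b) = Basepoint d"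
  by (simp_all add: medial_graph_def)

lemma smoothing_mate:
  assumes "k \<in> corners G"
  shows "smoothing_mate G t k \<in> corners G" "smoothing_mate G t (smoothing_mate G t k) = k"
    "smoothing_mate G t k \<noteq> k"
  using assms by (auto simp: smoothing_mate_def mates involutions mates_neq split: smoothing.split)

lemma ribbon_of_smoothing_mate:
  assumes "k \<in> corners G"
  shows "ribbon_of G (smoothing_mate G t k) = ribbon_of G k"
  using assms
  by (cases t) (auto simp: smoothing_mate_def ribbon_of_def mates involutions end_side)

lemma arrow_cases [consumes 1, case_names Outward Inward Along Around]:
  assumes "e \<in> arrows"
  obtains k where "e = Outward k" "k \<in> corners G"
  | k where "e = Inward k" "k \<in> corners G"
  | k where "e = Along k" "k \<in> corners G"
  | d b where "e = Around d b" "d \<in> bare_discs G"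
  using assms unfolding arrows_eq by blast

lemma mem_arrows [simp]:
  "Outward k \<in> arrows \<longleftrightarrow> k \<in> corners G"
  "Inward k \<in> arrows \<longleftrightarrow> k \<in> corners G"
  "Along k \<in> arrows \<longleftrightarrow> k \<in> corners G"
  "Around d b \<in> arrows \<longleftrightarrow> d \<in> bare_discs G"
  unfolding arrows_eq by blast+

lemma finite_arrows: "finite arrows"
proof -
  have *: "{Around d b |d b. d \<in> bare_discs G} = case_prod Around ` (bare_discs G \<times> UNIV)"
    by auto
  then show ?thesis
    unfolding arrows_eq * using finite_bare finite_corners by simp
qed

lemma reversible_flow: "reversible_flow arrows (next_arrow G s) (flip G)"
proof (rule reversible_flow.intro)
  fix e assume "e \<in> arrows"
  then have "next_arrow G s e \<in> arrows \<and> flip G e \<in> arrows \<and> flip G (flip G e) = e \<and>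
      next_arrow G s (flip G (next_arrow G s e)) = flip G e \<and> flip G e \<noteq> e \<and> next_arrow G s e \<noteq> flip G e"
    by (cases rule: arrow_cases)
      (simp_all add: mates involutions mates_neq smoothing_mate ribbon_of_smoothing_mate)
  then show "next_arrow G s e \<in> arrows" "flip G e \<in> arrows" "flip G (flip G e) = e"
      "next_arrow G s (flip G (next_arrow G s e)) = flip G e" "flip G e \<noteq> e" "next_arrow G s e \<noteq> flip G e"
    by blast+
qed (rule finite_arrows)

sublocale flow: reversible_flow arrows "next_arrow G s" "flip G" for s
  by (rule reversible_flow)

lemma head_eq_tail_next:
  assumes "e \<in> arrows"
  shows "head (medial_graph G) e = tail (medial_graph G) (next_arrow G s e)"
  using assms by (cases rule: arrow_cases) (simp_all add: ribbon_of_smoothing_mate)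

text \<open>Makes the cycle weight function applicable, whose properties are stated for
  \<open>closed_curves\<close> only; absence of backtracking is \<open>p_neq_f\<close>.\<close>

lemma cyc_closed_curve:
  assumes "e \<in> arrows"
  shows "flow.cyc s e \<in> closed_curves G"
proof -
  let ?p = "next_arrow G s"
  let ?l = "least_power ?p e"
  let ?xs = "support ?p e"
  note l = flow.least_power_props[OF assms, of s]
  have "head (medial_graph G) (?xs ! i) = tail (medial_graph G) (?xs ! (Suc i mod length ?xs)) \<and>
           ?xs ! (Suc i mod length ?xs) \<noteq> flip G (?xs ! i)" if i: "i < length ?xs" for i
  proof -
    have "?xs ! (Suc i mod length ?xs) = ?p (?xs ! i)"
      using i l funpow_mod_eq[OF l(1), of "Suc i"] by simp
    moreover have "?xs ! i \<in> arrows"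
      using i flow.pow_closed[OF assms] by simp
    ultimately show ?thesis
      using head_eq_tail_next flow.p_neq_f by metis
  qed
  moreover have "set ?xs \<subseteq> arrows" using flow.pow_closed[OF assms] by auto
  moreover have "?xs \<noteq> []" using l by simp
  ultimately show ?thesis
    unfolding flow.cyc_def closed_curves_def by blast
qed

lemma balanced_next:
  assumes a: "a \<in> arrow_coverings G" and v: "v \<in> verts (medial_graph G)"
    and e: "e \<in> a" "head (medial_graph G) e = v"
  obtains e' where "e' \<in> a" "tail (medial_graph G) e' = v"
proof -
  have "a \<subseteq> arrows" using a by (auto simp: arrow_coverings_def)
  then have "finite {e \<in> a. head (medial_graph G) e = v}"
    using flow.finite_X by (auto intro: finite_subset)
  then have "card {e \<in> a. head (medial_graph G) e = v} > 0"
    using e by (auto simp: card_gt_0_iff)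
  then have "card {e \<in> a. tail (medial_graph G) e = v} > 0"
    using a v by (auto simp: arrow_coverings_def)
  then have "{e \<in> a. tail (medial_graph G) e = v} \<noteq> {}" by (metis card.empty less_irrefl)
  then show ?thesis using that by auto
qed

text \<open>At a two-valent corner, balance forces an arriving arrow to be continued, and the only
  continuation other than turning back is the next arrow; at a midpoint this is coherence.
  Conversely, \<open>next_arrow\<close> permutes the finite set \<open>a\<close> and matches the
  arrows entering a vertex with those leaving it.\<close>

lemma coherent_coverings:
  "{a \<in> arrow_coverings G. \<forall>e\<in>ribbons G. s e \<in> coherent_smoothings G a e} = flow.coverings s"
proof (intro equalityI subsetI)
  fix a assume "a \<in> {a \<in> arrow_coverings G. \<forall>e\<in>ribbons G. s e \<in> coherent_smoothings G a e}"
  then have a: "a \<in> arrow_coverings G"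
    and coh: "\<And>k. k \<in> corners G \<Longrightarrow> Inward k \<in> a \<longleftrightarrow> Outward (smoothing_mate G (s (ribbon_of G k)) k) \<in> a"
    by (auto simp: ribbons_def coherent_smoothings_def ribbon_of_def)
  have sub: "a \<subseteq> arrows" and one: "\<And>e. e \<in> arrows \<Longrightarrow> (e \<in> a) \<noteq> (flip G e \<in> a)"
    using a by (auto simp: arrow_coverings_def)
  have corner: "Along k \<in> a \<or> Inward k \<in> a"
    if "k \<in> corners G" "e \<in> a" "head (medial_graph G) e = Corner k" for k e
  proof -
    have "Corner k \<in> verts (medial_graph G)" using that by (simp add: medial_graph_def)
    from balanced_next[OF a this that(2,3)]
    obtain e' where "e' \<in> a" "tail (medial_graph G) e' = Corner k" .
    then show ?thesis by (cases e') auto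
  qed
  have "next_arrow G s e \<in> a" if e: "e \<in> a" for e
  proof (cases e)
    case (Outward k)
    then have k: "k \<in> corners G" using e sub by auto
    then have "Inward k \<notin> a" using one[of "Outward k"] e Outward by auto
    then show ?thesis using corner[OF k e] Outward by auto
  next
    case (Inward k)
    then have k: "k \<in> corners G" using e sub by auto
    then show ?thesis using coh[OF k] e Inward by auto
  next
    case (Along k)
    then have k: "k \<in> corners G" using e sub by auto
    then have "Along (arc_mate G k) \<notin> a" using one[of "Along k"] e Along by auto
    then show ?thesis using corner[OF mates(3)[OF k] e] Along by auto
  next
    case (Around d b)
    then show ?thesis using e by simp
  qed
  then show "a \<in> flow.coverings s"
    using sub one by (auto simp: flow.coverings_def)
next
  fix a assume a: "a \<in> flow.coverings s"
  let ?p = "next_arrow G s"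
  have sub: "a \<subseteq> arrows" and one: "\<And>e. e \<in> arrows \<Longrightarrow> (e \<in> a) \<noteq> (flip G e \<in> a)"
    using a by (auto simp: flow.coverings_def)
  have p_iff: "?p e \<in> a \<longleftrightarrow> e \<in> a" if "e \<in> arrows" for e
    using flow.covering_cyc[OF a] flow.cyc_p[OF that, of s] flow.p_closed[OF that] that by metis
  have inj: "inj_on ?p a"
    by (rule inj_onI) (use flow.pow_inj[where n = 1 and s = s] sub in auto)
  have "?p ` a = a"
  proof (rule endo_inj_surj)
    show "finite a" using sub flow.finite_X by (rule finite_subset)
  qed (use a inj in \<open>auto simp: flow.coverings_def\<close>)
  have "card {e \<in> a. head (medial_graph G) e = v} = card {e \<in> a. tail (medial_graph G) e = v}" for v
  proof (rule bij_betw_same_card, rule bij_betw_imageI)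
    show "inj_on ?p {e \<in> a. head (medial_graph G) e = v}"
      using inj by (rule inj_on_subset) auto
    show "?p ` {e \<in> a. head (medial_graph G) e = v} = {e \<in> a. tail (medial_graph G) e = v}"
    proof (intro equalityI subsetI)
      fix e assume "e \<in> {e \<in> a. tail (medial_graph G) e = v}"
      moreover from this obtain e' where "e' \<in> a" "e = ?p e'" using \<open>?p ` a = a\<close> by blast
      ultimately show "e \<in> ?p ` {e \<in> a. head (medial_graph G) e = v}"
        using head_eq_tail_next[of e' s] sub by auto
    qed (use head_eq_tail_next[of _ s] p_iff sub in auto)
  qed
  moreover have "s e \<in> coherent_smoothings G a e" if "e \<in> ribbons G" for e
  proof -
    obtain k where k: "k \<in> corners G" "e = ribbon_of G k" using \<open>e \<in> ribbons G\<close> by (auto simp: ribbons_def)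
    have "k' \<in> corners G \<and> ribbon_of G k' = e" if "k' \<in> e" for k'
      using that k ribbon_of_smoothing_mate[of _ SA] ribbon_of_smoothing_mate[of _ SB] mates
      by (auto simp: smoothing_mate_def ribbon_of_def[of _ k])
    then show ?thesis
      using p_iff[of "Inward _"] by (auto simp: coherent_smoothings_def)
  qed
  ultimately show "a \<in> {a \<in> arrow_coverings G. \<forall>e\<in>ribbons G. s e \<in> coherent_smoothings G a e}"
    using sub one by (auto simp: arrow_coverings_def)
qed

text \<open>A cycle through corners visits exactly one class of \<open>smoothed_arcs\<close>, and
  its two orientations are identified in \<open>cyc_pair\<close>; each bare disc adds its
  loop.\<close>

lemma card_cyc_pairs:
  "card (flow.cyc_pair s ` arrows) = card (classes (corners G) (smoothed_arcs G s)) + card (bare_discs G)"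
proof -
  let ?u = "flow.cyc_pair s"
  define E where "E = (smoothed_arcs G s \<union> (smoothed_arcs G s)\<inverse>)\<^sup>* \<inter> corners G \<times> corners G"
  have E: "equiv (corners G) E" unfolding E_def by (rule equiv_symcl)
  \<comment> \<open>The class of corners, or the bare disc, that an arrow touches. It is invariant
    under steps and flips, hence a function of the unoriented cycle.\<close>
  define \<kappa> where "\<kappa> e = (case e of Outward k \<Rightarrow> Inl (E `` {k}) | Inward k \<Rightarrow> Inl (E `` {k})
      | Along k \<Rightarrow> Inl (E `` {k}) | Around d b \<Rightarrow> Inr d)" for e :: "('k, 'd) arrow"
  have rel: "(k, arc_mate G k) \<in> E" "(k, smoothing_mate G (s (ribbon_of G k)) k) \<in> E"
    if "k \<in> corners G" for k
    using that by (auto simp: E_def smoothed_arcs_def mates smoothing_mate intro!: r_into_rtrancl)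
  note E_eq = equiv_class_eq[OF E, symmetric]
  have inv: "\<kappa> (next_arrow G s e) = \<kappa> e" "\<kappa> (flip G e) = \<kappa> e" if "e \<in> arrows" for e
    using that by (cases rule: arrow_cases; simp add: \<kappa>_def E_eq[OF rel(1)] E_eq[OF rel(2)])+
  have \<kappa>: "\<kappa> e = \<kappa> e'" if "e \<in> arrows" "e' \<in> arrows" "?u e = ?u e'" for e e'
    by (rule flow.cyc_pair_invariant[OF inv that])
  have u_out: "?u (Outward k) = ?u (Inward k)" "?u (Outward k) = ?u (Along k)" if "k \<in> corners G" for k
    using that flow.cyc_pair_f[of "Outward k" s] flow.cyc_pair_p[of "Outward k" s] by (simp_all add:)
  have u_const: "?u (Outward k) = ?u (Outward k')" if kk': "(k, k') \<in> smoothed_arcs G s" for k k'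
  proof -
    have k: "k \<in> corners G" using that by (auto simp: smoothed_arcs_def)
    consider "k' = arc_mate G k" | "k' = smoothing_mate G (s (ribbon_of G k)) k"
      using kk' by (auto simp: smoothed_arcs_def)
    then show ?thesis
    proof cases
      case 1
      then show ?thesis
        using flow.cyc_pair_p[of "Along k" s] u_out[OF k] u_out[OF mates(3)[OF k]] k by simp
    next
      case 2
      then show ?thesis
        using flow.cyc_pair_p[of "Inward k" s] u_out[OF k] k by simp
    qed
  qed
  have kernel: "?u (Outward k) = ?u (Outward k') \<longleftrightarrow> (k, k') \<in> (smoothed_arcs G s \<union> (smoothed_arcs G s)\<inverse>)\<^sup>*"
    if "k \<in> corners G" "k' \<in> corners G" for k k'
  proof
    assume "?u (Outward k) = ?u (Outward k')"
    then have "E `` {k} = E `` {k'}"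
      using \<kappa>[of "Outward k" "Outward k'"] that by (simp add: \<kappa>_def)
    then show "(k, k') \<in> (smoothed_arcs G s \<union> (smoothed_arcs G s)\<inverse>)\<^sup>*"
      using eq_equiv_class_iff[OF E that] by (simp add: E_def)
  qed (rule symcl_rtrancl_const, use u_const in auto)
  have "?u ` arrows = (\<lambda>k. ?u (Outward k)) ` corners G \<union> (\<lambda>d. ?u (Around d True)) ` bare_discs G"
  proof -
    have around: "?u (Around d b) = ?u (Around d True)" if "d \<in> bare_discs G" for d b
      using that flow.cyc_pair_f[of "Around d True" s] by (cases b) auto
    have "?u e \<in> (\<lambda>k. ?u (Outward k)) ` corners G \<union> (\<lambda>d. ?u (Around d True)) ` bare_discs G"
      if "e \<in> arrows" for e
      using that
    proof (cases rule: arrow_cases)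
      case (Around d b)
      then show ?thesis using around[of d b] by blast
    qed (auto simp: u_out[symmetric])
    then show ?thesis by auto
  qed
  moreover have "(\<lambda>k. ?u (Outward k)) ` corners G \<inter> (\<lambda>d. ?u (Around d True)) ` bare_discs G = {}"
  proof -
    have "?u (Outward k) \<noteq> ?u (Around d True)" if "k \<in> corners G" "d \<in> bare_discs G" for k d
      using \<kappa>[of "Outward k" "Around d True"] that by (auto simp: \<kappa>_def)
    then show ?thesis by blast
  qed
  moreover have "inj_on (\<lambda>d. ?u (Around d True)) (bare_discs G)"
  proof (rule inj_onI)
    fix d d' assume "d \<in> bare_discs G" "d' \<in> bare_discs G" "?u (Around d True) = ?u (Around d' True)"
    then show "d = d'" using \<kappa>[of "Around d True" "Around d' True"] by (simp add: \<kappa>_def)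
  qed
  ultimately show ?thesis
    using card_classes[OF kernel] finite_corners finite_bare
    by (simp add: card_Un_disjoint card_image)
qed

text \<open>The exponent is the full number of cycles; the shift by one in the bracket enters only
  through the prefactor.\<close>

theorem vertex_model:
  fixes A r :: "'f::field"
  assumes \<delta>: "cycle_weight_function G \<delta>"
  shows "(\<Sum>a\<in>arrow_coverings G. W G \<delta> A (rho G r a)) =
    (\<Sum>s\<in>ribbons G \<rightarrow>\<^sub>E UNIV. (\<Prod>e\<in>ribbons G. case s e of SA \<Rightarrow> 1 | SB \<Rightarrow> r) *
       (- (A ^ 2) - A powi (-2)) ^ (card (classes (corners G) (smoothed_arcs G s)) + card (bare_discs G)))"
proof -
  have fin: "finite (ribbons G)" using finite_corners by (simp add: ribbons_def)
  have "finite (UNIV :: smoothing set)"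
    by (rule finite_subset[of _ "{SA, SB}"]) (auto intro: smoothing.exhaust)
  then have fin_S: "finite (ribbons G \<rightarrow>\<^sub>E (UNIV :: smoothing set))"
    using fin by (intro finite_PiE) auto
  have fin_a: "finite (arrow_coverings G)"
    by (rule finite_subset[of _ "Pow arrows"]) (auto simp: arrow_coverings_def flow.finite_X)
  let ?c = "\<lambda>s. \<Prod>e\<in>ribbons G. case s e of SA \<Rightarrow> 1 | SB \<Rightarrow> r"
  let ?w = "\<lambda>c. (- (A ^ 2)) powi \<delta> c"
  let ?P = "\<lambda>a s. \<forall>e\<in>ribbons G. s e \<in> coherent_smoothings G a e"
  have coh: "(\<Pi>\<^sub>E e\<in>ribbons G. coherent_smoothings G a e) = {s \<in> ribbons G \<rightarrow>\<^sub>E UNIV. ?P a s}" for a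
    by (auto simp: PiE_iff extensional_def)
  have cyc: "oriented_cycles G (s, a) = flow.cyc s ` a" for s a
    by (auto simp: oriented_cycles_def flow.cyc_def)
  have "(\<Sum>a\<in>arrow_coverings G. W G \<delta> A (rho G r a)) =
      (\<Sum>a\<in>arrow_coverings G. \<Sum>s\<in>{s \<in> ribbons G \<rightarrow>\<^sub>E UNIV. ?P a s}. ?c s * (\<Prod>c\<in>flow.cyc s ` a. ?w c))"
    by (simp add: W_rho[OF fin] coh cyc)
  also have "\<dots> = (\<Sum>s\<in>ribbons G \<rightarrow>\<^sub>E UNIV. \<Sum>a\<in>{a \<in> arrow_coverings G. ?P a s}. ?c s * (\<Prod>c\<in>flow.cyc s ` a. ?w c))"
    by (rule sum.swap_restrict[OF fin_a fin_S])
  also have "\<dots> = (\<Sum>s\<in>ribbons G \<rightarrow>\<^sub>E UNIV. ?c s * (\<Sum>a\<in>flow.coverings s. \<Prod>c\<in>flow.cyc s ` a. ?w c))"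
    by (simp add: coherent_coverings sum_distrib_left)
  also have "\<dots> = (\<Sum>s\<in>ribbons G \<rightarrow>\<^sub>E UNIV. ?c s *
       (- (A ^ 2) - A powi (-2)) ^ (card (classes (corners G) (smoothed_arcs G s)) + card (bare_discs G)))"
  proof (rule sum.cong[OF refl])
    fix s
    have "?w (flow.cyc s e) + ?w (flow.cyc s (flip G e)) = - (A ^ 2) - A powi (-2)" if "e \<in> arrows" for e
    proof -
      have "opposite_curve G (flow.cyc s e) = flow.cyc s (flip G e)"
        by (simp add: opposite_curve_def flow.reverse_cyc that)
      then have "\<delta> (flow.cyc s e) \<in> {1, -1}" "\<delta> (flow.cyc s (flip G e)) = - \<delta> (flow.cyc s e)"
        using \<delta> cyc_closed_curve[OF that, of s] by (auto simp: cycle_weight_function_def)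
      \<comment> \<open>For either value of \<open>\<delta>\<close> the two terms are
        \<open>- (A ^ 2)\<close> and its inverse, in one order or the other.\<close>
      then show ?thesis by (auto simp: power_int_minus)
    qed
    then show "?c s * (\<Sum>a\<in>flow.coverings s. \<Prod>c\<in>flow.cyc s ` a. ?w c) = ?c s *
       (- (A ^ 2) - A powi (-2)) ^ (card (classes (corners G) (smoothed_arcs G s)) + card (bare_discs G))"
      by (subst flow.sum_coverings) (auto simp: card_cyc_pairs)
  qed
  finally show ?thesis .
qed

end

section \<open>The Kauffman bracket of a diagram\<close>

lemma exhaust_mod4: "i = 0 \<or> i = 1 \<or> i = 2 \<or> i = 3" for i :: 4
proof (cases i)
  case (of_int z)
  then have "z = 0 \<or> z = 1 \<or> z = 2 \<or> z = 3" by auto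
  then show ?thesis using of_int by auto
qed

text \<open>The origin of the factor A^N: one \<open>A\<close> for each crossing turns the weights 1
  and \<open>A powi (-2)\<close> into \<open>A\<close> and its inverse.\<close>

lemma prod_smoothing_weights:
  fixes A :: "'f::field"
  assumes "finite X" and "A \<noteq> 0"
  shows "A ^ card X * (\<Prod>x\<in>X. case s x of SA \<Rightarrow> 1 | SB \<Rightarrow> A powi (-2)) =
    A powi (int (card {x \<in> X. s x = SA}) - int (card {x \<in> X. s x = SB}))"
proof -
  have "A * A powi (-2) = inverse A"
    using assms(2) by (simp add: power_int_minus power2_eq_square field_simps)
  then have "A ^ card X * (\<Prod>x\<in>X. case s x of SA \<Rightarrow> 1 | SB \<Rightarrow> A powi (-2)) =
      (\<Prod>x\<in>X. if s x = SA then A else inverse A)"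
    unfolding prod_constant[symmetric] prod.distrib[symmetric]
    by (intro prod.cong refl) (auto split: smoothing.split)
  also have "\<dots> = A ^ card (X \<inter> {x. s x = SA}) * inverse A ^ card (X \<inter> - {x. s x = SA})"
    by (subst prod.If_cases[OF assms(1)]) simp
  also have "X \<inter> {x. s x = SA} = {x \<in> X. s x = SA}" by blast
  also have "X \<inter> - {x. s x = SA} = {x \<in> X. s x = SB}"
  proof -
    have "s x \<noteq> SA \<longleftrightarrow> s x = SB" for x by (cases "s x") simp_all
    then show ?thesis by blast
  qed
  also have "A ^ card {x \<in> X. s x = SA} * inverse A ^ card {x \<in> X. s x = SB} =
      A powi (int (card {x \<in> X. s x = SA}) - int (card {x \<in> X. s x = SB}))"
    using assms(2) by (simp add: power_int_diff power_inverse divide_inverse)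
  finally show ?thesis .
qed

lemma sum_PiE_bij:
  fixes h :: "'a \<Rightarrow> 'b" and F :: "('b \<Rightarrow> 'c) \<Rightarrow> 'd::comm_monoid_add"
  assumes "bij_betw h I J"
  shows "(\<Sum>s\<in>J \<rightarrow>\<^sub>E UNIV. F s) = (\<Sum>t\<in>I \<rightarrow>\<^sub>E UNIV. F (restrict (t \<circ> inv_into I h) J))"
proof (rule sum.reindex_bij_witness[of _ "\<lambda>t. restrict (t \<circ> inv_into I h) J" "\<lambda>s. restrict (s \<circ> h) I"])
  fix s :: "'b \<Rightarrow> 'c" assume s: "s \<in> J \<rightarrow>\<^sub>E UNIV"
  show *: "restrict (restrict (s \<circ> h) I \<circ> inv_into I h) J = s"
  proof
    fix y show "restrict (restrict (s \<circ> h) I \<circ> inv_into I h) J y = s y"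
      using s assms bij_betw_inv_into_right[OF assms, of y] bij_betw_apply[OF bij_betw_inv_into[OF assms], of y]
      by (cases "y \<in> J") auto
  qed
  show "F (restrict (restrict (s \<circ> h) I \<circ> inv_into I h) J) = F s" by (simp only: *)
next
  fix t :: "'a \<Rightarrow> 'c" assume t: "t \<in> I \<rightarrow>\<^sub>E UNIV"
  show "restrict (restrict (t \<circ> inv_into I h) J \<circ> h) I = t"
  proof
    fix x show "restrict (restrict (t \<circ> inv_into I h) J \<circ> h) I x = t x"
      using t bij_betw_inv_into_left[OF assms, of x] bij_betw_apply[OF assms, of x]
      by (cases "x \<in> I") auto
  qed
qed auto

lemma indet_nonzero: "indet \<noteq> 0"
  by (simp add: indet_def Zero_fract_def eq_fract)

text \<open>Needed to lower the exponent of the loop value by one, which gives -1 for the empty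
  diagram. After multiplication by A^2, vanishing would mean A^4 + 1 = 0, but this polynomial has
  constant term 1.\<close>

lemma loop_value_nonzero: "- (indet ^ 2) - indet powi (-2) \<noteq> 0"
proof
  let ?x = "[:0, 1:] :: int poly"
  assume "- (indet ^ 2) - indet powi (-2) = 0"
  then have "indet powi (-2) = - (indet ^ 2)" by (simp add: eq_neg_iff_add_eq_0 add.commute)
  then have "indet ^ 2 * indet powi (-2) = - (indet ^ 2 * indet ^ 2)" by simp
  then have "indet ^ 2 * indet ^ 2 + 1 = 0"
    using indet_nonzero by (simp add: power_int_minus)
  then have "Fract (?x * ?x * (?x * ?x) + 1) 1 = 0"
    by (simp add: indet_def power2_eq_square One_fract_def)
  then have "?x * ?x * (?x * ?x) + 1 = 0"
    by (simp add: Zero_fract_def eq_fract)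
  then have "poly (?x * ?x * (?x * ?x) + 1) 0 = 0" by simp
  then show False by simp
qed

locale checkerboard_diagram =
  fixes D :: "('x, 'o, 'r) diagram" and B :: "'r set"
  assumes link_diagram: "link_diagram D"
    and checkerboard: "checkerboard D B"
    and disc_regions: "\<forall>r\<in>B. disc_region D r"
begin

section \<open>Black corners and the mates of the unsigning\<close>

definition black :: "('x \<times> 4) set" where
  "black = {d \<in> darts D. region D (Inl d) \<in> B}"

abbreviation "R \<equiv> unsigning (tait_graph D B)"

lemma other_end: "d \<in> darts D \<Longrightarrow> other_end D d \<in> darts D" "d \<in> darts D \<Longrightarrow> other_end D (other_end D d) = d"
  and region_next: "d \<in> darts D \<Longrightarrow> region D (Inl (next_corner D d)) = region D (Inl d)"
  and finite_crossings: "finite (crossings D)"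
  using link_diagram unfolding link_diagram_def by blast+

lemma mem_darts [simp]: "(x, i) \<in> darts D \<longleftrightarrow> x \<in> crossings D"
  by (simp add: darts_def)

lemma next_corner_darts: "d \<in> darts D \<Longrightarrow> next_corner D d \<in> darts D"
  using other_end(1)[of d] by (cases "other_end D d") (simp add: next_corner_def)

lemma finite_darts: "finite (darts D)"
  unfolding darts_def by (intro finite_cartesian_product finite_crossings finite)

lemma black_darts: "black \<subseteq> darts D"
  unfolding black_def by blast

lemma finite_black: "finite black"
  using black_darts finite_darts by (rule finite_subset)

lemma inj_next_corner: "inj_on (next_corner D) (darts D)"
proof (rule inj_onI)
  fix d d' assume d: "d \<in> darts D" "d' \<in> darts D" "next_corner D d = next_corner D d'"
  from d(3) have "other_end D d = other_end D d'"
    by (cases "other_end D d"; cases "other_end D d'") (simp add: next_corner_def)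
  then have "other_end D (other_end D d) = other_end D (other_end D d')" by (rule arg_cong)
  then show "d = d'" unfolding other_end(2)[OF d(1)] other_end(2)[OF d(2)] .
qed

text \<open>Makes the \<open>inv_into\<close> in \<open>fattening\<close> a genuine inverse of the
  rotation; surjectivity comes from finiteness.\<close>

lemma bij_next_corner: "bij_betw (next_corner D) black black"
proof -
  have inj: "inj_on (next_corner D) black"
    by (rule inj_on_subset[OF inj_next_corner black_darts])
  have "next_corner D d \<in> black" if "d \<in> black" for d
    using that by (simp add: black_def next_corner_darts region_next)
  then have "next_corner D ` black \<subseteq> black" by blast
  then have "next_corner D ` black = black" using finite_black inj by (intro endo_inj_surj)
  with inj show ?thesis unfolding bij_betw_def by blast
qed

lemma black_alternate:
  assumes "x \<in> crossings D"
  shows "(x, i + 1) \<in> black \<longleftrightarrow> (x, i) \<notin> black"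
proof -
  have "(region D (Inl (x, i + 1)) \<in> B) \<noteq> (region D (Inl (x, i + 1 - 1)) \<in> B)"
    using checkerboard assms unfolding checkerboard_def by blast
  then show ?thesis using assms by (simp add: black_def)
qed

lemma black_twin: "(x, i + 2) \<in> black \<longleftrightarrow> (x, i) \<in> black"
proof (cases "x \<in> crossings D")
  case True
  then have "(x, i + 1 + 1) \<in> black \<longleftrightarrow> (x, i) \<in> black"
    using black_alternate[OF True] by blast
  then show ?thesis by (simp add: add.assoc)
qed (simp add: black_def)

lemma corners_R: "corners R = black \<times> UNIV"
  by (simp add: black_def unsigning_def fattening_def tait_graph_def Let_def)

lemma mem_corners [simp]: "((x, i), l) \<in> corners R \<longleftrightarrow> (x, i) \<in> black"
  by (simp add: corners_R)

lemma bare_discs_R: "bare_discs R = B - (\<lambda>d. region D (Inl d)) ` black"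
  by (simp add: black_def unsigning_def fattening_def tait_graph_def Let_def)

text \<open>The odd indices are the positive edges. There an end of the transverse band is a long
  side of the old ribbon, so its two corners belong to opposite half-edges.\<close>

lemma end_mate_R: "end_mate R ((x, i), l) = (if i = 1 \<or> i = 3 then (x, i + 2) else (x, i), \<not> l)"
  by (simp add: unsigning_def fattening_def tait_graph_def Let_def)

lemma side_mate_R: "side_mate R ((x, i), l) = (if i = 1 \<or> i = 3 then (x, i) else (x, i + 2), \<not> l)"
  by (simp add: unsigning_def fattening_def tait_graph_def Let_def)

lemma arc_mate_R:
  "arc_mate R (d, True) = (next_corner D d, False)"
  "arc_mate R (d, False) = (inv_into black (next_corner D) d, True)"
  by (simp_all add: black_def unsigning_def fattening_def tait_graph_def Let_def)

lemma closed_ribbons_R: "closed_ribbons R"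
proof
  show "finite (corners R)" unfolding corners_R by (intro finite_cartesian_product finite_black finite)
  \<comment> \<open>Only the unbounded region can touch no side, and it is white.\<close>
  have "B \<subseteq> region D ` sides D"
    using checkerboard unfolding checkerboard_def regions_def by blast
  moreover have "finite (circles D)" using link_diagram unfolding link_diagram_def by blast
  then have "finite (sides D)"
    unfolding sides_def by (simp add: finite_darts)
  ultimately have "finite B" by (meson finite_imageI finite_subset)
  then show "finite (bare_discs R)" unfolding bare_discs_R by (rule finite_Diff)
next
  fix k assume "k \<in> corners R"
  then obtain x i l where k: "k = ((x, i), l)" "(x, i) \<in> black"
    by (cases k) (auto simp: corners_R)
  \<comment> \<open>Opposite corners have indices of the same parity, so both half-edges of an edge
    carry the same sign and iterated mates stay in the same case.\<close>
  have i: "i = 0 \<or> i = 1 \<or> i = 2 \<or> i = 3" by (rule exhaust_mod4)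
  have i2: "(x, i + 2) \<in> black" using k black_twin by blast
  show "end_mate R k \<in> corners R" "side_mate R k \<in> corners R"
    using k(2) i2 unfolding k(1) end_mate_R side_mate_R corners_R by auto
  show "end_mate R (end_mate R k) = k" "side_mate R (side_mate R k) = k"
    "end_mate R k \<noteq> k" "side_mate R k \<noteq> k" "end_mate R (side_mate R k) = side_mate R (end_mate R k)"
    using i unfolding k(1) by (auto simp: end_mate_R side_mate_R)
  show "arc_mate R k \<in> corners R" "arc_mate R (arc_mate R k) = k" "arc_mate R k \<noteq> k"
    using k(2) bij_betw_apply[OF bij_next_corner k(2)] bij_betw_inv_into_left[OF bij_next_corner k(2)]
      bij_betw_inv_into_right[OF bij_next_corner k(2)] bij_betw_apply[OF bij_betw_inv_into[OF bij_next_corner] k(2)]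
    unfolding k(1) by (cases l; simp add: arc_mate_R corners_R)+
qed

sublocale ribbons: closed_ribbons R
  by (rule closed_ribbons_R)

text \<open>The strand running along the side of the ribbon on which the corner lies.\<close>

fun strand :: "('x \<times> 4) \<times> bool \<Rightarrow> 'x \<times> 4" where
  "strand ((x, i), l) = (x, if l then i else i + 1)"

text \<open>The strand \<open>i\<close> separates the corners \<open>i - 1\<close> and
  \<open>i\<close>, exactly one of which is black; this one determines the ribbon corner.\<close>

lemma bij_strand: "bij_betw strand (corners R) (darts D)"
proof (rule bij_betw_imageI)
  show "inj_on strand (corners R)"
  proof (rule inj_onI)
    fix k k' assume k: "k \<in> corners R" "k' \<in> corners R" "strand k = strand k'"
    obtain x i l where "k = ((x, i), l)" by (metis surj_pair)
    moreover obtain y j m where "k' = ((y, j), m)" by (metis surj_pair)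
    ultimately show "k = k'"
      using k black_alternate[of x i] black_alternate[of x j] black_darts
      by (cases l; cases m) auto
  qed
  show "strand ` corners R = darts D"
  proof (intro equalityI subsetI)
    fix d assume "d \<in> darts D"
    then obtain x i where d: "d = (x, i)" "x \<in> crossings D" by (cases d) auto
    show "d \<in> strand ` corners R"
    proof (cases "(x, i) \<in> black")
      case True
      then have "((x, i), True) \<in> corners R" by simp
      then show ?thesis using d by (intro image_eqI[of _ _ "((x, i), True)"]) auto
    next
      case False
      then have "((x, i - 1), False) \<in> corners R"
        using black_alternate[OF d(2), of "i - 1"] False by simp
      then show ?thesis using d by (intro image_eqI[of _ _ "((x, i - 1), False)"]) auto
    qed
  qed (use black_darts in \<open>auto simp: corners_R\<close>)
qed

text \<open>The shift by -1 in \<open>next_corner\<close> cancels the shift by +1 in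
  \<open>strand\<close>.\<close>

lemma strand_next: "strand (next_corner D d, False) = other_end D d"
  by (simp add: next_corner_def split: prod.split)

text \<open>An arc on the boundary of a black disc runs along one edge of the diagram. Against the
  rotation, \<open>other_end\<close> is applied at the preceding corner and undone by
  involutivity.\<close>

lemma strand_arc_mate:
  assumes "k \<in> corners R"
  shows "strand (arc_mate R k) = other_end D (strand k)"
proof -
  obtain d l where k: "k = (d, l)" "d \<in> black" using assms by (auto simp: corners_R)
  have strand_True: "strand (d, True) = d" for d by (cases d) simp
  show ?thesis
  proof (cases l)
    case True
    then show ?thesis using k by (simp add: arc_mate_R strand_next strand_True)
  next
    case False
    let ?d' = "inv_into black (next_corner D) d"
    have d': "?d' \<in> black" "next_corner D ?d' = d"
      using bij_betw_apply[OF bij_betw_inv_into[OF bij_next_corner] k(2)]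
        bij_betw_inv_into_right[OF bij_next_corner k(2)] by auto
    then have "strand k = other_end D ?d'"
      using strand_next[of ?d'] False k by simp
    then show ?thesis
      using other_end(2)[OF subsetD[OF black_darts d'(1)]] False k strand_True by (simp add: arc_mate_R)
  qed
qed

text \<open>Where the unsigning pays off. For \<open>SA\<close> and an even index, the strands
  \<open>i\<close> and \<open>i + 1\<close> bounding one black corner are joined; for an odd index,
  the exchanged mates join \<open>i\<close> with \<open>i + 3 = i - 1\<close>. Either way the pairs
  are 0, 1 and 2, 3, and \<open>SB\<close> gives the other two.\<close>

lemma strand_smoothing_mate:
  "strand (smoothing_mate R t ((x, i), l)) = (x, joined_strand t (snd (strand ((x, i), l))))"
  using exhaust_mod4[of i]
  by (cases t; cases l) (auto simp: smoothing_mate_def end_mate_R side_mate_R joined_strand_def)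

section \<open>Ribbons and crossings\<close>

definition ribbon_at :: "'x \<Rightarrow> (('x \<times> 4) \<times> bool) set" where
  "ribbon_at x = {k \<in> corners R. fst (fst k) = x}"

text \<open>Colours alternate around the crossing, so exactly the corners \<open>i\<close> and
  \<open>i + 2\<close> are black. Each carries two ribbon corners, and these four form one orbit of
  the mates for either sign.\<close>

lemma ribbon_of_R:
  assumes "k \<in> corners R"
  shows "ribbon_of R k = ribbon_at (fst (fst k))"
proof -
  obtain x i l where k: "k = ((x, i), l)" by (metis surj_pair)
  have i: "(x, i) \<in> black" using assms k by simp
  then have x: "x \<in> crossings D" using black_darts by auto
  have i': "(x, i + 2) \<in> black" "(x, i + 1) \<notin> black" "(x, i + 3) \<notin> black"
    using i black_twin[of x i] black_alternate[OF x, of i] black_twin[of x "i + 1"]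
    by (simp_all add: add.assoc)
  have "(x, j) \<in> black \<longleftrightarrow> j = i \<or> j = i + 2" for j
  proof -
    have "j = i + (j - i)" by simp
    then have "j = i \<or> j = i + 1 \<or> j = i + 2 \<or> j = i + 3"
      using exhaust_mod4[of "j - i"] by (metis add_0_right)
    then show ?thesis using i i' by blast
  qed
  then have "k' \<in> ribbon_at x \<longleftrightarrow> k' \<in> {((x, i), True), ((x, i), False), ((x, i + 2), True), ((x, i + 2), False)}" for k'
    by (cases k'; cases "fst k'"; cases "snd k'") (auto simp: ribbon_at_def corners_R)
  then have "ribbon_at x = {((x, i), True), ((x, i), False), ((x, i + 2), True), ((x, i + 2), False)}"
    by blast
  also have "\<dots> = ribbon_of R k"
    using exhaust_mod4[of i] unfolding k
    by (cases l) (auto simp: ribbon_of_def end_mate_R side_mate_R)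
  finally show ?thesis by (simp add: k)
qed

lemma bij_ribbon_at: "bij_betw ribbon_at (crossings D) (ribbons R)"
proof (rule bij_betw_imageI)
  have ex: "\<exists>i. ((x, i), True) \<in> corners R" if "x \<in> crossings D" for x
    using black_alternate[OF that, of 0] by (metis mem_corners)
  show "inj_on ribbon_at (crossings D)"
  proof (rule inj_onI)
    fix x y assume "x \<in> crossings D" "ribbon_at x = ribbon_at y"
    moreover from ex[OF this(1)] obtain i where "((x, i), True) \<in> ribbon_at x"
      by (auto simp: ribbon_at_def)
    ultimately have "((x, i), True) \<in> ribbon_at y" by simp
    then show "x = y" by (simp add: ribbon_at_def)
  qed
  show "ribbon_at ` crossings D = ribbons R"
  proof
    show "ribbon_at ` crossings D \<subseteq> ribbons R"
    proof
      fix e assume "e \<in> ribbon_at ` crossings D"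
      then obtain x where x: "x \<in> crossings D" "e = ribbon_at x" by auto
      obtain i where "((x, i), True) \<in> corners R" using ex[OF x(1)] by auto
      moreover from ribbon_of_R[OF this] have "e = ribbon_of R ((x, i), True)" by (simp add: x)
      ultimately show "e \<in> ribbons R" unfolding ribbons_def by blast
    qed
    show "ribbons R \<subseteq> ribbon_at ` crossings D"
    proof
      fix e assume "e \<in> ribbons R"
      then obtain k where k: "k \<in> corners R" "e = ribbon_of R k" unfolding ribbons_def by blast
      then have "fst (fst k) \<in> crossings D" using black_darts by (cases k) auto
      then show "e \<in> ribbon_at ` crossings D" using k ribbon_of_R by blast
    qed
  qed
qed

text \<open>A black disc region has a single face, so \<open>z\<close> lies on the face of
  \<open>Inr c\<close>. Faces link only sides at crossings, hence this face is a singleton.\<close>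

lemma black_circle_side_isolated:
  assumes z: "Inr c \<in> sides D" "z \<in> sides D"
    and r: "region D (Inr c) \<in> B" "region D z = region D (Inr c)"
  shows "z = Inr c"
proof -
  let ?R = "{(Inl d, Inl (next_corner D d)) |d. d \<in> darts D} :: (('x \<times> 4) + ('o \<times> bool)) rel"
  let ?E = "(?R \<union> ?R\<inverse>)\<^sup>* \<inter> sides D \<times> sides D"
  have face: "?E `` {y} \<in> {f \<in> faces D. region D ` f = {region D y}}" if "y \<in> sides D" for y
  proof -
    have "region D y' = region D y" if "(y, y') \<in> ?E" for y'
    proof -
      have "(y, y') \<in> (?R \<union> ?R\<inverse>)\<^sup>*" using that by blast
      then have "region D y = region D y'"
        by (rule symcl_rtrancl_const) (auto simp: region_next)
      then show ?thesis by simp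
    qed
    moreover have "y \<in> ?E `` {y}" using that by blast
    ultimately have "region D ` (?E `` {y}) = {region D y}" by blast
    moreover have "?E `` {y} \<in> faces D"
      unfolding faces_def classes_def using that by (rule quotientI)
    ultimately show ?thesis by blast
  qed
  have "card {f \<in> faces D. region D ` f = {region D (Inr c)}} = 1"
    using disc_regions r(1) by (simp add: disc_region_def)
  then obtain f where f: "{f \<in> faces D. region D ` f = {region D (Inr c)}} = {f}"
    by (rule card_1_singletonE)
  have "?E `` {z} = f" "?E `` {Inr c} = f"
    using face[OF z(2)] face[OF z(1)] unfolding r(2) f by blast+
  moreover have "z \<in> ?E `` {z}" using z(2) by blast
  ultimately have "(Inr c, z) \<in> ?E" by blast
  then have path: "(Inr c, z) \<in> (?R \<union> ?R\<inverse>)\<^sup>*" by blast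
  \<comment> \<open>This map sends all sides at crossings to \<open>None\<close> and separates the
    sides of crossingless components; it is constant along faces.\<close>
  have "case_sum (\<lambda>_. None) Some (Inr c :: ('x \<times> 4) + ('o \<times> bool)) = case_sum (\<lambda>_. None) Some z"
    by (rule symcl_rtrancl_const[where h = "case_sum (\<lambda>_. None) Some", OF path]) auto
  then show ?thesis by (cases z) auto
qed

text \<open>A bare disc is a black region without crossing corners, hence bounded by crossingless
  components only and, being a disc, by exactly one.\<close>

lemma card_bare_discs: "card (bare_discs R) = card (circles D)"
proof -
  \<comment> \<open>The black side of \<open>c\<close>, whichever label it carries.\<close>
  define inner where
    "inner c = (if region D (Inr (c, True)) \<in> B then (c, True) else (c, False))" for c
  have sides: "(region D (Inr (c, True)) \<in> B) \<noteq> (region D (Inr (c, False)) \<in> B)" if "c \<in> circles D" for c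
    using that checkerboard unfolding checkerboard_def by blast
  have side: "Inr (inner c) \<in> sides D" "region D (Inr (inner c)) \<in> B" if "c \<in> circles D" for c
    using sides[OF that] that by (auto simp: inner_def sides_def)
  have "bij_betw (\<lambda>c. region D (Inr (inner c))) (circles D) (bare_discs R)"
  proof (rule bij_betw_imageI)
    show "inj_on (\<lambda>c. region D (Inr (inner c))) (circles D)"
    proof (rule inj_onI)
      fix c c' assume c: "c \<in> circles D" "c' \<in> circles D"
        "region D (Inr (inner c)) = region D (Inr (inner c'))"
      from black_circle_side_isolated[OF side(1)[OF c(2)] side(1)[OF c(1)] side(2)[OF c(2)] c(3)]
      have "inner c = inner c'" by simp
      then show "c = c'" by (simp add: inner_def split: if_splits)
    qed
    show "(\<lambda>c. region D (Inr (inner c))) ` circles D = bare_discs R"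
    proof (intro equalityI subsetI)
      fix r assume "r \<in> (\<lambda>c. region D (Inr (inner c))) ` circles D"
      then obtain c where c: "c \<in> circles D" "r = region D (Inr (inner c))" by blast
      have "region D (Inr (inner c)) \<notin> (\<lambda>d. region D (Inl d)) ` black"
      proof
        assume "region D (Inr (inner c)) \<in> (\<lambda>d. region D (Inl d)) ` black"
        then obtain d where d: "region D (Inr (inner c)) = region D (Inl d)" "d \<in> black"
          by (rule imageE)
        have "d \<in> darts D" by (rule subsetD[OF black_darts d(2)])
        then have "Inl d \<in> sides D" unfolding sides_def by simp
        from black_circle_side_isolated[OF side(1)[OF c(1)] this side(2)[OF c(1)] d(1)[symmetric]] show False
          by (rule Inl_not_Inr[THEN notE])
      qed
      with side(2)[OF c(1)] show "r \<in> bare_discs R"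
        unfolding c(2) bare_discs_R by (rule DiffI)
    next
      fix r assume r: "r \<in> bare_discs R"
      then have "r \<in> B" by (simp add: bare_discs_R)
      then have "r \<in> region D ` sides D"
        using checkerboard unfolding checkerboard_def regions_def by blast
      then obtain z where z: "z \<in> sides D" "r = region D z" by blast
      show "r \<in> (\<lambda>c. region D (Inr (inner c))) ` circles D"
      proof (cases z)
        case (Inl d)
        then have "d \<in> darts D" using z(1) by (auto simp: sides_def)
        then have "d \<in> black" using z(2) \<open>r \<in> B\<close> Inl unfolding black_def by blast
        then show ?thesis using r z(2) unfolding bare_discs_R Inl by blast
      next
        case (Inr y)
        obtain c b where y: "y = (c, b)" by (cases y)
        have c: "c \<in> circles D" using z(1) unfolding Inr y sides_def by auto
        have "region D (Inr (c, b)) \<in> B" using \<open>r \<in> B\<close> z(2) unfolding Inr y by simp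
        then have "inner c = y"
          using sides[OF c] by (cases b) (simp_all add: inner_def y)
        then show ?thesis using c z(2) unfolding Inr by blast
      qed
    qed
  qed
  then show ?thesis by (simp add: bij_betw_same_card)
qed

text \<open>\<open>strand\<close> carries the relation joining corners into cycles onto the one
  joining darts into curves of the state; bare discs account for the crossingless
  components.\<close>

lemma num_curves_R:
  assumes s: "\<And>x. x \<in> crossings D \<Longrightarrow> s (ribbon_at x) = t x"
  shows "card (classes (corners R) (smoothed_arcs R s)) + card (bare_discs R) = num_curves D t"
proof -
  have mate: "strand (smoothing_mate R (s (ribbon_of R k)) k) =
      (fst (strand k), joined_strand (t (fst (strand k))) (snd (strand k)))" if k: "k \<in> corners R" for k
  proof -
    obtain x i l where k_eq: "k = ((x, i), l)" by (metis surj_pair)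
    have "x \<in> crossings D" using k black_darts k_eq by auto
    then show ?thesis
      using k s[of x] strand_smoothing_mate[of "t x" x i l] ribbon_of_R[OF k] by (simp add: k_eq)
  qed
  have strand: "strand ` corners R = darts D" using bij_strand by (simp add: bij_betw_def)
  have "map_prod strand strand ` smoothed_arcs R s =
      (\<lambda>k. (strand k, other_end D (strand k))) ` corners R \<union>
      (\<lambda>k. (strand k, (fst (strand k), joined_strand (t (fst (strand k))) (snd (strand k))))) ` corners R"
  proof -
    have "smoothed_arcs R s = (\<lambda>k. (k, arc_mate R k)) ` corners R \<union>
        (\<lambda>k. (k, smoothing_mate R (s (ribbon_of R k)) k)) ` corners R"
      unfolding smoothed_arcs_def by blast
    then show ?thesis
      by (simp add: image_Un image_image mate strand_arc_mate cong: image_cong_simp)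
  qed
  also have "\<dots> = (\<lambda>d. (d, other_end D d)) ` strand ` corners R \<union>
      (\<lambda>d. (d, (fst d, joined_strand (t (fst d)) (snd d)))) ` strand ` corners R"
    by (simp only: image_image)
  also have "\<dots> = {(d, other_end D d) |d. d \<in> darts D}
      \<union> {((x, i), (x, joined_strand (t x) i)) |x i. x \<in> crossings D}"
    unfolding strand by (auto simp: image_iff)
  finally have *: "map_prod strand strand ` smoothed_arcs R s = {(d, other_end D d) |d. d \<in> darts D}
      \<union> {((x, i), (x, joined_strand (t x) i)) |x i. x \<in> crossings D}" .
  have "smoothed_arcs R s \<subseteq> corners R \<times> corners R"
    using ribbons.mates(3) ribbons.smoothing_mate(1) unfolding smoothed_arcs_def by blast
  from card_classes_bij[OF bij_strand this] show ?thesis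
    by (simp add: num_curves_def card_bare_discs *)
qed

theorem kauffman_bracket_vertex_model:
  assumes "cycle_weight_function R \<delta>"
  shows "kauffman_bracket indet D =
    inverse (- (indet ^ 2) - indet powi (-2)) * indet ^ card (crossings D) *
    (\<Sum>a\<in>arrow_coverings R. W R \<delta> indet (rho R (indet powi (-2)) a))"
proof -
  let ?A = "indet" and ?d = "- (indet ^ 2) - indet powi (-2)"
  let ?F = "\<lambda>s. (\<Prod>e\<in>ribbons R. case s e of SA \<Rightarrow> 1 | SB \<Rightarrow> ?A powi (-2)) *
       ?d ^ (card (classes (corners R) (smoothed_arcs R s)) + card (bare_discs R))"
  let ?c = "\<lambda>t. \<Prod>x\<in>crossings D. case t x of SA \<Rightarrow> 1 | SB \<Rightarrow> ?A powi (-2)"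
  let ?s = "\<lambda>t. restrict (t \<circ> inv_into (crossings D) ribbon_at) (ribbons R)"
  have F: "?F (?s t) = ?c t * ?d ^ num_curves D t" for t
  proof -
    have s: "?s t (ribbon_at x) = t x" if "x \<in> crossings D" for x
      using bij_betw_inv_into_left[OF bij_ribbon_at that] bij_betw_apply[OF bij_ribbon_at that] by simp
    have "(\<Prod>e\<in>ribbons R. case ?s t e of SA \<Rightarrow> 1 | SB \<Rightarrow> ?A powi (-2)) =
        (\<Prod>x\<in>crossings D. case ?s t (ribbon_at x) of SA \<Rightarrow> 1 | SB \<Rightarrow> ?A powi (-2))"
      by (rule prod.reindex_bij_betw[OF bij_ribbon_at, symmetric])
    also have "\<dots> = ?c t"
      by (rule prod.cong[OF refl]) (simp only: s)
    finally show ?thesis by (simp only: num_curves_R[of "?s t" t, OF s])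
  qed
  have "(\<Sum>a\<in>arrow_coverings R. W R \<delta> ?A (rho R (?A powi (-2)) a)) = (\<Sum>s\<in>ribbons R \<rightarrow>\<^sub>E UNIV. ?F s)"
    by (rule ribbons.vertex_model[OF assms])
  also have "\<dots> = (\<Sum>t\<in>states D. ?F (?s t))"
    unfolding states_def by (rule sum_PiE_bij[OF bij_ribbon_at])
  also have "\<dots> = (\<Sum>t\<in>states D. ?c t * ?d ^ num_curves D t)"
    by (rule sum.cong[OF refl F])
  finally have "(\<Sum>a\<in>arrow_coverings R. W R \<delta> ?A (rho R (?A powi (-2)) a)) =
      (\<Sum>t\<in>states D. ?c t * ?d ^ num_curves D t)" .
  \<comment> \<open>Dividing by the loop value lowers its exponent by one, as an integer because
    \<open>num_curves D t\<close> may be 0.\<close>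
  moreover have "inverse ?d * ?A ^ card (crossings D) * (?c t * ?d ^ num_curves D t) =
      ?A powi (int (card {x \<in> crossings D. t x = SA}) - int (card {x \<in> crossings D. t x = SB}))
        * ?d powi (int (num_curves D t) - 1)" for t
    unfolding prod_smoothing_weights[OF finite_crossings indet_nonzero, symmetric]
    using loop_value_nonzero by (simp add: power_int_diff divide_inverse)
  ultimately show ?thesis
    by (simp only: kauffman_bracket_def sum_distrib_left)
qed

end

theorem theorem13:
  fixes D :: "('x, 'o, 'r) diagram"
    and B :: "'r set"
    and \<delta> :: "(('x \<times> 4) \<times> bool, 'r) arrow list set \<Rightarrow> int"
  assumes "link_diagram D"
    and "checkerboard D B"
    and "\<forall>r\<in>B. disc_region D r"
    and "cycle_weight_function (unsigning (tait_graph D B)) \<delta>"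
  shows "kauffman_bracket indet D =
    inverse (- (indet ^ 2) - indet powi (-2)) * indet ^ card (crossings D) *
    (\<Sum>a\<in>arrow_coverings (unsigning (tait_graph D B)).
       W (unsigning (tait_graph D B)) \<delta> indet
         (rho (unsigning (tait_graph D B)) (indet powi (-2)) a))"
  using assms by (intro checkerboard_diagram.kauffman_bracket_vertex_model) (simp add: checkerboard_diagram_def)

end
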